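(* Let $\kappa>0$, $n\in\{1,2,\dots\}$ and $\nu\in\{+,-\}$, and consider the problem $$-u''(x)=\lambda u(x)\,[1+\kappa (u'(x))^2]^{3/2},\quad 0<x<1,\qquad u(0)=u(1)=0. \qquad (\mathrm{P}_\lambda)$$ Let $B=\int_0^1 \frac{d\theta}{\sqrt{\theta^{-4}-1}}$. Then: 1. Problem $(\mathrm{P}_\lambda)$ has an $S_n^\nu$-solution if and only if $8n^2B^2<\lambda<n^2\pi^2$. 2. The $S_n^\nu$-solution of $(\mathrm{P}_\lambda)$ is unique if it exists. Denote it by $u_\lambda$. 3. For all $\lambda$ with $8n^2B^2<\lambda<n^2\pi^2$, all of the humps of $u_\lambda$ are the same, and the first hump is symmetric around $\frac{1}{2n}$. 4. $\nu u_\lambda'(0)$ is strictly decreasing as a function of $\lambda\in(8n^2B^2,n^2\pi^2)$. 5. $u_\lambda$ satisfies $$\lim_{\lambda\downarrow 8n^2B^2}\|u_\lambda\|_\infty=\frac{1}{2nB\sqrt{\kappa}}\qquad\text{and}\qquad \lim_{\lambda\uparrow n^2\pi^2}\|u_\lambda\|_\infty=\lim_{\lambda\uparrow n^2\pi^2}u_\lambda\Big(\frac{1}{2n}\Big)=0.$$ 6. The pointwise limit $u_{8n^2B^2}:=\lim_{\lambda\downarrow 8n^2B^2}u_\lambda$ provides a solution of $(\mathrm{P}_\lambda)$ at $\lambda=8n^2B^2$ which is singular at $x=\frac jn$, $j=0,1,\dots,n$, in the sense that $$\nu(-1)^j\,u_{8n^2B^2}'\Big(\frac jn\Big)=\infty,\qquad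 j=0,1,\dots,n.$$
   Context: $C^1_0[0,1]$ is the space of $C^1$ functions on $[0,1]$ vanishing at $0$ and $1$. For $n\in\{1,2,\dots\}$ and $\nu\in\{+,-\}$, $$S_n^\nu:=\{u\in C_0^1[0,1] : u \text{ has exactly } n-1 \text{ simple zeros in } (0,1), \text{ and } \nu u \text{ is positive near } 0\}$$ (positive near $0$ means on some interval $(0,\varepsilon)$; $\nu$ is identified with $\pm1$). A zero $\tau$ of $u$ is simple if $u'(\tau)\neq 0$. An $S_n^\nu$-solution is a (classical, $C^2$) solution $u$ of the problem with $u\in S_n^\nu$. A hump (bump) of $u$ is the restriction of $u$ to an interval between two consecutive zeros of $u$; two humps are the same if, up to a translation in $x$ and possibly a change of sign of $u$, their graphs coincide. In item 6, the singular solution satisfies the equation away from the points $j/n$, and at these points the derivative is infinite (one-sided at $0$ and $1$). *)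

theory Defs
  imports "HOL-Analysis.Analysis"
begin

text \<open>
  Functions on \<open>[0,1]\<close> are represented by total functions on the reals; only their values on
  \<open>{0..1}\<close> matter, and two of them are identified when they agree on \<open>{0..1}\<close>.
  Derivatives relative to \<open>{0..1}\<close> are one-sided at the end points.
\<close>

definition deriv_on :: "real set \<Rightarrow> (real \<Rightarrow> real) \<Rightarrow> real \<Rightarrow> real" where
  "deriv_on S u x = vector_derivative u (at x within S)"

definition C1_on :: "real set \<Rightarrow> (real \<Rightarrow> real) \<Rightarrow> bool" where
  "C1_on S u \<longleftrightarrow> u differentiable_on S \<and> continuous_on S (deriv_on S u)"

definition C2_on :: "real set \<Rightarrow> (real \<Rightarrow> real) \<Rightarrow> bool" where
  "C2_on S u \<longleftrightarrow> C1_on S u \<and> C1_on S (deriv_on S u)"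

definition C10 :: "(real \<Rightarrow> real) set" where
  "C10 = {u. C1_on {0..1} u \<and> u 0 = 0 \<and> u 1 = 0}"

definition simple_zeros :: "(real \<Rightarrow> real) \<Rightarrow> real set" where
  "simple_zeros u = {\<tau> \<in> {0<..<1}. u \<tau> = 0 \<and> deriv u \<tau> \<noteq> 0}"

text \<open>The sign \<open>\<nu>\<close> is a real number, meant to be \<open>1\<close> or \<open>-1\<close>.\<close>

definition S_class :: "nat \<Rightarrow> real \<Rightarrow> (real \<Rightarrow> real) set" where
  "S_class n \<nu> = {u \<in> C10. finite (simple_zeros u) \<and> card (simple_zeros u) = n - 1
                         \<and> (\<forall>\<^sub>F x in at_right 0. 0 < \<nu> * u x)}"

text \<open>To be used for open \<open>S\<close> on which \<open>u\<close> is twice differentiable.\<close>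

definition satisfies_equation :: "real \<Rightarrow> real \<Rightarrow> real set \<Rightarrow> (real \<Rightarrow> real) \<Rightarrow> bool" where
  "satisfies_equation \<kappa> l S u \<longleftrightarrow>
     (\<forall>x\<in>S. - deriv (deriv u) x = l * u x * (1 + \<kappa> * (deriv u x)\<^sup>2) powr (3/2))"

definition classical_solution :: "real \<Rightarrow> real \<Rightarrow> (real \<Rightarrow> real) \<Rightarrow> bool" where
  "classical_solution \<kappa> l u \<longleftrightarrow>
     C2_on {0..1} u \<and> satisfies_equation \<kappa> l {0<..<1} u \<and> u 0 = 0 \<and> u 1 = 0"

definition S_solution :: "real \<Rightarrow> nat \<Rightarrow> real \<Rightarrow> real \<Rightarrow> (real \<Rightarrow> real) \<Rightarrow> bool" where
  "S_solution \<kappa> n \<nu> l u \<longleftrightarrow> classical_solution \<kappa> l u \<and> u \<in> S_class n \<nu>"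

definition B_const :: real where
  "B_const = integral {0..1} (\<lambda>\<theta>. 1 / sqrt (1 / \<theta> ^ 4 - 1))"

definition sup_norm :: "(real \<Rightarrow> real) \<Rightarrow> real" where
  "sup_norm u = (SUP x\<in>{0..1}. \<bar>u x\<bar>)"

definition consecutive_zeros :: "(real \<Rightarrow> real) \<Rightarrow> real \<Rightarrow> real \<Rightarrow> bool" where
  "consecutive_zeros u a b \<longleftrightarrow>
     0 \<le> a \<and> a < b \<and> b \<le> 1 \<and> u a = 0 \<and> u b = 0 \<and> (\<forall>x\<in>{a<..<b}. u x \<noteq> 0)"

text \<open>A hump is represented by its graph.\<close>

definition hump :: "(real \<Rightarrow> real) \<Rightarrow> real \<Rightarrow> real \<Rightarrow> (real \<times> real) set" where
  "hump u a b = (\<lambda>x. (x, u x)) ` {a..b}"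

definition humps :: "(real \<Rightarrow> real) \<Rightarrow> (real \<times> real) set set" where
  "humps u = {hump u a b | a b. consecutive_zeros u a b}"

definition same_hump :: "(real \<times> real) set \<Rightarrow> (real \<times> real) set \<Rightarrow> bool" where
  "same_hump G H \<longleftrightarrow> (\<exists>t. \<exists>s\<in>{1, -1}. H = (\<lambda>(x, y). (x + t, s * y)) ` G)"

definition symmetric_around :: "real \<Rightarrow> (real \<times> real) set \<Rightarrow> bool" where
  "symmetric_around c G \<longleftrightarrow> (\<lambda>(x, y). (2 * c - x, y)) ` G = G"

definition grid :: "nat \<Rightarrow> real set" where
  "grid n = {real j / real n | j. j \<le> n}"

text \<open>
  An infinite derivative at \<open>j/n\<close> means that the difference quotient taken inside \<open>[0,1]\<close>
  diverges; the condition is one-sided at \<open>0\<close> and \<open>1\<close>. Continuity is required because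
  the difference quotient may also diverge at a jump.
\<close>

definition singular_solution :: "real \<Rightarrow> nat \<Rightarrow> real \<Rightarrow> real \<Rightarrow> (real \<Rightarrow> real) \<Rightarrow> bool" where
  "singular_solution \<kappa> n \<nu> l u \<longleftrightarrow>
     continuous_on {0..1} u \<and> u 0 = 0 \<and> u 1 = 0 \<and>
     C2_on ({0<..<1} - grid n) u \<and> satisfies_equation \<kappa> l ({0<..<1} - grid n) u \<and>
     (\<forall>j\<le>n. let a = real j / real n in
        filterlim (\<lambda>x. \<nu> * (-1) ^ j * ((u x - u a) / (x - a))) at_top (at a within {0..1}))"

end

theory Submission
  imports Defs
begin

text \<open>
  Put \<open>q = 1 / sqrt (1 + \<kappa> u'\<^sup>2)\<close>, the cosine of the inclination of the graph of
  \<open>sqrt \<kappa> u\<close>. Differentiating \<open>q\<close> and inserting the equation shows that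
  \<open>q = c + \<kappa> l u\<^sup>2 / 2\<close> along a solution, where the constant \<open>c\<close> is the value of \<open>q\<close> at the
  zeros of \<open>u\<close> (lemma \<open>first_integral\<close>). At an interior extremum \<open>q = 1\<close>, which forces
  \<open>l > 0\<close> and \<open>0 < c < 1\<close> for every nonzero classical solution.

  The substitution \<open>u = M sin t\<close> with \<open>M\<^sup>2 = 2 (1 - c) / (\<kappa> l)\<close> turns the first integral into
  \<open>q = c + (1 - c) sin\<^sup>2 t\<close> and yields \<open>sqrt (l / 2) dx/dt = q / sqrt (1 + q)\<close>. The right-hand
  side contains neither \<open>\<kappa>\<close> nor \<open>l\<close>, it is smooth at the extrema of \<open>u\<close>, and it makes sense
  for all real \<open>t\<close>. Its primitive \<open>travel_time c\<close> is a homeomorphism of the line with inverse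
  \<open>angle c\<close>, so that \<open>profile \<kappa> l c x = M sin (angle c (sqrt (l / 2) x))\<close> is a solution on the
  whole line. Since \<open>travel_time c\<close> is odd and grows by \<open>2 quarter c\<close> under \<open>t \<mapsto> t + pi\<close>, all
  humps agree up to sign and are symmetric, and the zeros are equally spaced. There are
  \<open>n - 1\<close> of them inside the unit interval, with one at the end point \<open>1\<close>, exactly when
  \<open>l = 8 n\<^sup>2 (quarter c)\<^sup>2\<close>.

  The integrand grows with \<open>c\<close>, so \<open>quarter\<close> is strictly increasing. It is continuous with
  \<open>quarter 0 = B_const\<close> and \<open>quarter 1 = pi / (2 sqrt 2)\<close>. Hence \<open>l\<close> runs exactly through the
  stated interval while \<open>c\<close> runs through the open unit interval, and \<open>c\<close> is a continuous
  increasing function of \<open>l\<close>. The boundary slope and the height are explicit in \<open>c\<close> and \<open>l\<close>,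
  which gives their monotonicity and limits.

  No other solutions exist: eliminating \<open>u'\<close> by the first integral leaves
  \<open>u'' = - l u / (c + \<kappa> l u\<^sup>2 / 2)\<^sup>3\<close> with a Lipschitz right-hand side, so a solution is
  determined by \<open>u 0\<close> and \<open>u' 0\<close> and coincides with a profile
  (lemma \<open>classical_solution_profile\<close>).

  As \<open>l\<close> decreases to its lower bound, \<open>c\<close> tends to \<open>0\<close>. The profile with \<open>c = 0\<close> is still
  defined, and it is the pointwise limit because \<open>angle c y\<close> is jointly continuous in \<open>c\<close> and
  \<open>y\<close>. But the derivative of \<open>travel_time 0\<close> vanishes at the multiples of \<open>pi\<close>, so its inverse
  has infinite slope there, and so does the limit profile at its zeros.
\<close>

section \<open>Travel time along a hump\<close>

text \<open>
  The cosine of the inclination of the graph of \<open>sqrt \<kappa> u\<close>, as a function of the phase \<open>t\<close>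
  in \<open>u = M sin t\<close>. The parameter \<open>c\<close> is its value at the zeros of \<open>u\<close>.
\<close>

definition slope_cos :: "real \<Rightarrow> real \<Rightarrow> real" where
  "slope_cos c t = c + (1 - c) * (sin t)\<^sup>2"

definition speed :: "real \<Rightarrow> real \<Rightarrow> real" where
  "speed c t = slope_cos c t / sqrt (1 + slope_cos c t)"

text \<open>
  The abscissa, in the unit \<open>1 / sqrt (l / 2)\<close>, as a function of the phase. An
  oriented integral is used so that negative phases need no separate treatment.
\<close>

definition travel_time :: "real \<Rightarrow> real \<Rightarrow> real" where
  "travel_time c t = (LBINT s=0..t. speed c s)"

definition quarter :: "real \<Rightarrow> real" where
  "quarter c = travel_time c (pi / 2)"

lemma slope_cos_bounds:
  assumes "c \<in> {0..1}"
  shows "c \<le> slope_cos c t" "slope_cos c t \<le> 1" "0 \<le> slope_cos c t" "(sin t)\<^sup>2 \<le> slope_cos c t"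
proof -
  have s: "0 \<le> (sin t)\<^sup>2" "(sin t)\<^sup>2 \<le> 1"
    by (auto simp: abs_square_le_1)
  show "c \<le> slope_cos c t" "0 \<le> slope_cos c t"
    using assms s by (auto simp: slope_cos_def)
  have "(1 - c) * (sin t)\<^sup>2 \<le> (1 - c) * 1" "0 \<le> c * (1 - (sin t)\<^sup>2)"
    using assms s mult_left_mono[of "(sin t)\<^sup>2" 1 "1 - c"] by auto
  then show "slope_cos c t \<le> 1" "(sin t)\<^sup>2 \<le> slope_cos c t"
    by (auto simp: slope_cos_def algebra_simps)
qed

lemma one_minus_slope_cos: "1 - slope_cos c t = (1 - c) * (cos t)\<^sup>2"
  unfolding slope_cos_def cos_squared_eq by (simp add: algebra_simps)

lemma slope_cos_mono:
  assumes "c \<le> d"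
  shows "slope_cos c t \<le> slope_cos d t" "slope_cos d t - slope_cos c t \<le> d - c"
proof -
  have "slope_cos d t - slope_cos c t = (d - c) * (cos t)\<^sup>2"
    using one_minus_slope_cos[of c t] one_minus_slope_cos[of d t] by (simp add: algebra_simps)
  moreover have "0 \<le> (d - c) * (cos t)\<^sup>2" "(d - c) * (cos t)\<^sup>2 \<le> d - c"
    using assms mult_left_mono[of "(cos t)\<^sup>2" 1 "d - c"] by (auto simp: abs_square_le_1)
  ultimately show "slope_cos c t \<le> slope_cos d t" "slope_cos d t - slope_cos c t \<le> d - c"
    by linarith+
qed

lemma slope_cos_strict_mono:
  assumes "c < d" "cos t \<noteq> 0"
  shows "slope_cos c t < slope_cos d t"
proof -
  have "slope_cos d t - slope_cos c t = (d - c) * (cos t)\<^sup>2"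
    using one_minus_slope_cos[of c t] one_minus_slope_cos[of d t] by (simp add: algebra_simps)
  moreover have "0 < (d - c) * (cos t)\<^sup>2"
    using assms by simp
  ultimately show ?thesis
    by linarith
qed

lemma ratio_sqrt_strict_mono:
  fixes p q :: real
  assumes "0 \<le> p" "p < q"
  shows "p / sqrt (1 + p) < q / sqrt (1 + q)"
proof -
  have "p\<^sup>2 * (1 + q) < q\<^sup>2 * (1 + p)"
  proof -
    have "p\<^sup>2 < q\<^sup>2" "0 \<le> p * q * (q - p)"
      using assms by (auto intro: power_strict_mono)
    then show ?thesis
      by (simp add: algebra_simps power2_eq_square)
  qed
  then have "sqrt (p\<^sup>2 * (1 + q)) < sqrt (q\<^sup>2 * (1 + p))"
    by simp
  then have "p * sqrt (1 + q) < q * sqrt (1 + p)"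
    using assms by (simp add: real_sqrt_mult)
  then show ?thesis
    using assms by (simp add: divide_simps mult_ac)
qed

lemma ratio_sqrt_lipschitz:
  fixes p q :: real
  assumes "0 \<le> p" "p \<le> q"
  shows "q / sqrt (1 + q) - p / sqrt (1 + p) \<le> q - p"
proof -
  have "p / sqrt (1 + q) \<le> p / sqrt (1 + p)"
    using assms by (intro divide_left_mono) auto
  then have "q / sqrt (1 + q) - p / sqrt (1 + p) \<le> (q - p) / sqrt (1 + q)"
    by (simp add: diff_divide_distrib)
  also have "\<dots> \<le> (q - p) / 1"
    using assms by (intro divide_left_mono) auto
  finally show ?thesis by simp
qed

lemma speed_nonneg: "c \<in> {0..1} \<Longrightarrow> 0 \<le> speed c t"
  using slope_cos_bounds[of c t] by (auto simp: speed_def)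

lemma speed_pos: "c \<in> {0..1} \<Longrightarrow> 0 < slope_cos c t \<Longrightarrow> 0 < speed c t"
  by (auto simp: speed_def)

lemma speed_mono:
  assumes "c \<in> {0..1}" "d \<in> {0..1}" "c \<le> d"
  shows "speed c t \<le> speed d t" "speed d t - speed c t \<le> d - c"
proof -
  note q = slope_cos_bounds(3)[OF assms(1), of t] slope_cos_mono[OF assms(3), of t]
  show "speed c t \<le> speed d t"
    using ratio_sqrt_strict_mono[of "slope_cos c t" "slope_cos d t"] q
    by (cases "slope_cos c t = slope_cos d t") (auto simp: speed_def)
  show "speed d t - speed c t \<le> d - c"
    using ratio_sqrt_lipschitz[of "slope_cos c t" "slope_cos d t"] q by (auto simp: speed_def)
qed

lemma slope_cos_shift [simp]: "slope_cos c (t + pi) = slope_cos c t"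
  "slope_cos c (- t) = slope_cos c t"
  by (auto simp: slope_cos_def)

lemma speed_shift [simp]: "speed c (t + pi) = speed c t" "speed c (- t) = speed c t"
  by (auto simp: speed_def)

lemma continuous_speed:
  assumes "c \<in> {0..1}"
  shows "continuous_on S (speed c)"
proof -
  have "sqrt (1 + slope_cos c t) \<noteq> 0" for t
    using slope_cos_bounds[OF assms, of t] by auto
  then show ?thesis
    unfolding speed_def slope_cos_def by (intro continuous_intros) auto
qed

lemma travel_time_deriv:
  assumes "c \<in> {0..1}"
  shows "(travel_time c has_real_derivative speed c t) (at t)"
proof -
  define N where "N = \<bar>t\<bar> + 1"
  have "((\<lambda>u. LBINT s=ereal 0..u. speed c s) has_vector_derivative speed c t) (at t within {- N..N})"
    by (rule interval_integral_FTC2) (auto simp: N_def continuous_speed[OF assms])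
  moreover have "at t within {- N..N} = at t"
    by (rule at_within_interior) (auto simp: N_def interior_atLeastAtMost_real)
  ultimately show ?thesis
    by (simp add: travel_time_def[abs_def] has_real_derivative_iff_has_vector_derivative zero_ereal_def)
qed

lemma travel_time_0 [simp]: "travel_time c 0 = 0"
  by (simp add: travel_time_def zero_ereal_def[symmetric])

text \<open>
  The symmetries of \<^term>\<open>travel_time\<close> below are identities between functions with equal
  derivatives; this avoids substitutions in the defining integral.
\<close>

lemma eq_of_deriv_eq:
  fixes f g :: "real \<Rightarrow> real"
  assumes "\<And>t. (f has_real_derivative h t) (at t)" "\<And>t. (g has_real_derivative h t) (at t)" "f t0 = g t0"
  shows "f t = g t"
proof -
  have "((\<lambda>t. f t - g t) has_real_derivative 0) (at t)" for t
    using DERIV_diff[OF assms(1,2), of t] by simp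
  then have "f t - g t = f t0 - g t0"
    using DERIV_isconst_all by blast
  then show ?thesis using assms(3) by simp
qed

lemma travel_time_uminus:
  assumes "c \<in> {0..1}"
  shows "travel_time c (- t) = - travel_time c t"
proof -
  have "((\<lambda>t. - travel_time c (- t)) has_real_derivative speed c t) (at t)" for t
    using DERIV_minus[OF DERIV_chain2[OF travel_time_deriv[OF assms, of "- t"] DERIV_minus[OF DERIV_ident]]]
    by simp
  from eq_of_deriv_eq[OF this travel_time_deriv[OF assms], of 0 t] show ?thesis
    by simp
qed

lemma travel_time_add_pi:
  assumes "c \<in> {0..1}"
  shows "travel_time c (t + pi) = travel_time c t + 2 * quarter c"
proof -
  have d1: "((\<lambda>t. travel_time c (t + pi)) has_real_derivative speed c t) (at t)" for t
    using travel_time_deriv[OF assms, of "t + pi"] by (simp add: DERIV_shift)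
  have d2: "((\<lambda>t. travel_time c t + 2 * quarter c) has_real_derivative speed c t) (at t)" for t
    using travel_time_deriv[OF assms, of t] by (auto intro!: derivative_eq_intros)
  have "travel_time c (- (pi / 2)) = - quarter c"
    by (simp add: travel_time_uminus[OF assms] quarter_def)
  then show ?thesis
    using eq_of_deriv_eq[OF d1 d2, of "- (pi / 2)"] by (simp add: quarter_def)
qed

lemma travel_time_add_int_pi:
  assumes "c \<in> {0..1}"
  shows "travel_time c (t + of_int j * pi) = travel_time c t + 2 * of_int j * quarter c"
proof (induction j rule: int_induct[where k = 0])
  case (step1 i)
  then show ?case
    using travel_time_add_pi[OF assms, of "t + of_int i * pi"] by (simp add: algebra_simps)
next
  case (step2 i)
  then show ?case
    using travel_time_add_pi[OF assms, of "t + of_int (i - 1) * pi"] by (simp add: algebra_simps)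
qed simp

text \<open>
  The case \<open>c = 0\<close> needs care, because there the derivative vanishes at the multiples of \<open>pi\<close>.
  If the function took equal values at two points it would be constant between them, hence
  \<open>sin\<close> would vanish on an interval, and so would its derivative \<open>cos\<close>.
\<close>

lemma travel_time_strict_mono:
  assumes "c \<in> {0..1}"
  shows "strict_mono (travel_time c)"
proof -
  have mono: "travel_time c s \<le> travel_time c t" if "s \<le> t" for s t
    by (rule DERIV_nonneg_imp_nondecreasing[OF that])
      (use travel_time_deriv[OF assms] speed_nonneg[OF assms] in blast)
  have "travel_time c s \<noteq> travel_time c t" if "s < t" for s t
  proof
    assume eq: "travel_time c s = travel_time c t"
    have sin0: "sin x = 0" if "x \<in> {s<..<t}" for x
    proof -
      have "((\<lambda>_. travel_time c s) has_real_derivative speed c x) (at x)"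
      proof (rule has_field_derivative_transform_within_open[OF travel_time_deriv[OF assms]])
        show "travel_time c y = travel_time c s" if "y \<in> {s<..<t}" for y
          using mono[of s y] mono[of y t] that eq by auto
      qed (use that in auto)
      then have "speed c x = 0"
        using DERIV_const DERIV_unique by blast
      then show ?thesis
        using slope_cos_bounds(4)[OF assms, of x] slope_cos_bounds(3)[OF assms, of x] speed_pos[OF assms, of x]
        by (smt (verit) zero_eq_power2 zero_le_power2)
    qed
    define x where "x = (s + t) / 2"
    have x: "x \<in> {s<..<t}" using \<open>s < t\<close> by (auto simp: x_def)
    have "((\<lambda>_. 0) has_real_derivative cos x) (at x)"
      by (rule has_field_derivative_transform_within_open[of sin _ _ "{s<..<t}"]) (use x sin0 in auto)
    then have "cos x = 0"
      using DERIV_const DERIV_unique by blast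
    then show False
      using sin0[OF x] sin_cos_squared_add[of x] by simp
  qed
  then show ?thesis
    using mono by (force simp: strict_mono_def less_le)
qed

lemma quarter_pos: "c \<in> {0..1} \<Longrightarrow> 0 < quarter c"
  using strict_monoD[OF travel_time_strict_mono, of c 0 "pi / 2"] by (simp add: quarter_def)

lemma travel_time_int_pi: "c \<in> {0..1} \<Longrightarrow> travel_time c (of_int j * pi) = 2 * of_int j * quarter c"
  using travel_time_add_int_pi[of c 0 j] by simp

lemma bij_travel_time:
  assumes "c \<in> {0..1}"
  shows "bij (travel_time c)"
proof -
  have "\<exists>t. travel_time c t = y" for y
  proof -
    obtain j :: int where j: "\<bar>y\<bar> / (2 * quarter c) < of_int j"
      using ex_less_of_int by blast
    have "\<bar>y\<bar> < 2 * of_int j * quarter c"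
      using j quarter_pos[OF assms] by (simp add: divide_simps mult_ac)
    then have "travel_time c (of_int (- j) * pi) \<le> y" "y \<le> travel_time c (of_int j * pi)"
      using travel_time_int_pi[OF assms, of j] travel_time_int_pi[OF assms, of "- j"] by auto
    moreover have "of_int (- j) * pi \<le> of_int j * pi"
      using j quarter_pos[OF assms] by (smt (verit) divide_nonneg_pos mult_right_mono of_int_minus pi_ge_zero)
    ultimately show ?thesis
      using IVT'[of "travel_time c" "of_int (- j) * pi" y "of_int j * pi"] travel_time_deriv[OF assms]
      by (meson DERIV_continuous_on has_field_derivative_at_within)
  qed
  then show ?thesis
    using strict_mono_imp_inj_on[OF travel_time_strict_mono[OF assms]]
    by (metis bij_def surj_def)
qed

text \<open>
  The substitution \<open>\<theta> = sin t\<close>, carried out by checking that \<open>travel_time 0 (arcsin \<theta>)\<close> is a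
  primitive of the integrand in the open interval. Continuity at the end points is enough for the
  fundamental theorem, so the singularity at \<open>\<theta> = 1\<close> does no harm.
\<close>

lemma quarter_0: "quarter 0 = B_const"
proof -
  define f where "f \<theta> = travel_time 0 (arcsin \<theta>)" for \<theta>
  have "((\<lambda>\<theta>. 1 / sqrt (1 / \<theta> ^ 4 - 1)) has_integral f 1 - f 0) {0..1}"
  proof (rule fundamental_theorem_of_calculus_interior)
    have "continuous_on UNIV (travel_time 0)"
      using travel_time_deriv[of 0] by (intro DERIV_continuous_on) auto
    then show "continuous_on {0..1} f"
      unfolding f_def
      by (rule continuous_on_compose2) (auto intro: continuous_on_subset[OF continuous_on_arcsin'])
    fix \<theta> :: real assume \<theta>: "\<theta> \<in> {0<..<1}"
    have "(f has_real_derivative speed 0 (arcsin \<theta>) * inverse (sqrt (1 - \<theta>\<^sup>2))) (at \<theta>)"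
      unfolding f_def using \<theta> by (intro DERIV_chain2[OF travel_time_deriv DERIV_arcsin]) auto
    moreover have "speed 0 (arcsin \<theta>) * inverse (sqrt (1 - \<theta>\<^sup>2)) = 1 / sqrt (1 / \<theta> ^ 4 - 1)"
    proof -
      have "speed 0 (arcsin \<theta>) * inverse (sqrt (1 - \<theta>\<^sup>2)) = \<theta>\<^sup>2 / (sqrt (1 + \<theta>\<^sup>2) * sqrt (1 - \<theta>\<^sup>2))"
        using \<theta> by (simp add: speed_def slope_cos_def field_simps)
      also have "sqrt (1 + \<theta>\<^sup>2) * sqrt (1 - \<theta>\<^sup>2) = sqrt (\<theta> ^ 4 * (1 / \<theta> ^ 4 - 1))"
        using \<theta> by (simp add: real_sqrt_mult[symmetric] algebra_simps power2_eq_square power4_eq_xxxx)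
      also have "\<dots> = \<theta>\<^sup>2 * sqrt (1 / \<theta> ^ 4 - 1)"
        using real_sqrt_abs[of "\<theta>\<^sup>2"] by (simp add: real_sqrt_mult)
      also have "\<theta>\<^sup>2 / \<dots> = 1 / sqrt (1 / \<theta> ^ 4 - 1)"
        using \<theta> by simp
      finally show ?thesis .
    qed
    ultimately show "(f has_vector_derivative 1 / sqrt (1 / \<theta> ^ 4 - 1)) (at \<theta>)"
      by (simp add: has_real_derivative_iff_has_vector_derivative)
  qed simp
  then have "B_const = f 1 - f 0"
    unfolding B_const_def by (rule integral_unique)
  then show ?thesis
    by (simp add: f_def quarter_def)
qed

text \<open>
  For \<open>c = 1\<close> the speed is constant: this is the linear limit of vanishing amplitude.
\<close>

lemma quarter_1: "quarter 1 = pi / (2 * sqrt 2)"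
proof -
  have "((\<lambda>t. t / sqrt 2) has_real_derivative speed 1 t) (at t)" for t
    by (auto intro!: derivative_eq_intros simp: speed_def slope_cos_def real_div_sqrt field_simps)
  from eq_of_deriv_eq[OF travel_time_deriv this, of 0 "pi / 2"] show ?thesis
    by (simp add: quarter_def)
qed

text \<open>
  The integrand changes by at most \<open>\<bar>d - c\<bar>\<close>, because \<open>q / sqrt (1 + q)\<close> is \<open>1\<close>-Lipschitz for
  nonnegative \<open>q\<close>. This is the source of all continuity in the parameter \<open>c\<close>.
\<close>

lemma travel_time_lipschitz:
  assumes "c \<in> {0..1}" "d \<in> {0..1}" "0 \<le> t"
  shows "\<bar>travel_time d t - travel_time c t\<bar> \<le> \<bar>d - c\<bar> * t"
proof -
  have *: "\<bar>travel_time d t - travel_time c t\<bar> \<le> \<bar>d - c\<bar> * t"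
    if cd: "c \<in> {0..1}" "d \<in> {0..1}" "c \<le> d" for c d
  proof -
    have der: "((\<lambda>t. travel_time d t - travel_time c t) has_real_derivative speed d t - speed c t) (at t)" for t
      by (rule DERIV_diff[OF travel_time_deriv[OF cd(2)] travel_time_deriv[OF cd(1)]])
    have der': "((\<lambda>t. (d - c) * t - (travel_time d t - travel_time c t)) has_real_derivative
       (d - c) - (speed d t - speed c t)) (at t)" for t
      by (rule DERIV_diff[OF DERIV_cmult_Id der])
    have "travel_time d 0 - travel_time c 0 \<le> travel_time d t - travel_time c t"
      using der speed_mono(1)[OF cd]
      by (intro DERIV_nonneg_imp_nondecreasing[OF assms(3), of "\<lambda>t. travel_time d t - travel_time c t"])
        (metis diff_ge_0_iff_ge)
    moreover have "(d - c) * 0 - (travel_time d 0 - travel_time c 0) \<le>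
      (d - c) * t - (travel_time d t - travel_time c t)"
      using der' speed_mono(2)[OF cd]
      by (intro DERIV_nonneg_imp_nondecreasing[OF assms(3),
            of "\<lambda>t. (d - c) * t - (travel_time d t - travel_time c t)"])
        (metis diff_ge_0_iff_ge)
    ultimately show ?thesis using cd by simp
  qed
  show ?thesis
    using *[of c d] *[of d c] assms by (cases "c \<le> d") (auto simp: abs_minus_commute)
qed

lemma quarter_strict_mono: "strict_mono_on {0..1} quarter"
proof (rule strict_mono_onI)
  fix c d :: real assume cd: "c \<in> {0..1}" "d \<in> {0..1}" "c < d"
  have der: "((\<lambda>t. travel_time d t - travel_time c t) has_real_derivative speed d t - speed c t) (at t)" for t
    by (rule DERIV_diff[OF travel_time_deriv[OF cd(2)] travel_time_deriv[OF cd(1)]])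
  have "travel_time d 0 - travel_time c 0 < travel_time d (pi / 2) - travel_time c (pi / 2)"
  proof (rule DERIV_pos_imp_increasing_open[where f = "\<lambda>t. travel_time d t - travel_time c t"])
    fix t :: real assume "0 < t" "t < pi / 2"
    then have "cos t \<noteq> 0"
      using cos_gt_zero_pi[of t] by auto
    then have "0 < speed d t - speed c t"
      using ratio_sqrt_strict_mono[of "slope_cos c t" "slope_cos d t"] slope_cos_bounds(3)[of c t]
        slope_cos_strict_mono[of c d t] cd by (auto simp: speed_def)
    then show "\<exists>y. ((\<lambda>t. travel_time d t - travel_time c t) has_real_derivative y) (at t) \<and> 0 < y"
      using der by blast
  next
    show "continuous_on {0..pi / 2} (\<lambda>t. travel_time d t - travel_time c t)"
      by (rule DERIV_continuous_on[OF has_field_derivative_at_within[OF der]])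
  qed simp
  then show "quarter c < quarter d" by (simp add: quarter_def)
qed

lemma continuous_on_quarter: "continuous_on {0..1} quarter"
proof -
  have "(pi / 2)-lipschitz_on {0..1} quarter"
    using travel_time_lipschitz[of _ _ "pi / 2"]
    by (auto intro!: lipschitz_onI simp: quarter_def dist_real_def mult_ac abs_minus_commute)
  then show ?thesis by (rule lipschitz_on_continuous_on)
qed

section \<open>The angle as a function of position\<close>

definition angle :: "real \<Rightarrow> real \<Rightarrow> real" where
  "angle c = inv (travel_time c)"

lemma angle_travel_time [simp]: "c \<in> {0..1} \<Longrightarrow> angle c (travel_time c t) = t"
  using bij_travel_time[of c] by (simp add: angle_def bij_is_inj)

lemma travel_time_angle [simp]: "c \<in> {0..1} \<Longrightarrow> travel_time c (angle c y) = y"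
  using bij_travel_time[of c] by (simp add: angle_def bij_is_surj surj_f_inv_f)

lemma angle_eqI: "c \<in> {0..1} \<Longrightarrow> travel_time c t = y \<Longrightarrow> angle c y = t"
  by auto

lemma angle_0 [simp]: "c \<in> {0..1} \<Longrightarrow> angle c 0 = 0"
  by (rule angle_eqI) auto

lemma angle_less_iff: "c \<in> {0..1} \<Longrightarrow> angle c y < t \<longleftrightarrow> y < travel_time c t"
  using strict_mono_less[OF travel_time_strict_mono, of c "angle c y" t] by simp

lemma less_angle_iff: "c \<in> {0..1} \<Longrightarrow> t < angle c y \<longleftrightarrow> travel_time c t < y"
  using strict_mono_less[OF travel_time_strict_mono, of c t "angle c y"] by simp

lemma angle_add_int:
  assumes "c \<in> {0..1}"
  shows "angle c (y + 2 * of_int j * quarter c) = angle c y + of_int j * pi"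
  using assms by (intro angle_eqI) (simp_all add: travel_time_add_int_pi)

lemma angle_uminus: "c \<in> {0..1} \<Longrightarrow> angle c (- y) = - angle c y"
  by (rule angle_eqI) (simp_all add: travel_time_uminus)

lemma continuous_angle:
  assumes "c \<in> {0..1}"
  shows "isCont (angle c) y"
proof -
  have "isCont (angle c) (travel_time c (angle c y))"
    using assms by (intro isCont_inverse_function[of 1 _ _ "travel_time c"])
      (auto intro: DERIV_isCont[OF travel_time_deriv])
  then show ?thesis using assms by simp
qed

text \<open>
  The positivity condition only excludes the case \<open>c = 0\<close> at zeros of the sine, which is where
  the limit solution becomes singular.
\<close>

lemma angle_deriv:
  assumes "c \<in> {0..1}" "0 < slope_cos c (angle c y)"
  shows "(angle c has_real_derivative 1 / speed c (angle c y)) (at y)"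
  using DERIV_inverse_function[OF travel_time_deriv, of c "angle c" y "y - 1" "y + 1"]
    assms continuous_angle speed_pos[OF assms]
  by (simp add: inverse_eq_divide)

lemma travel_time_lipschitz_abs:
  assumes "c \<in> {0..1}" "d \<in> {0..1}"
  shows "\<bar>travel_time d t - travel_time c t\<bar> \<le> \<bar>d - c\<bar> * \<bar>t\<bar>"
  using travel_time_lipschitz[OF assms, of "\<bar>t\<bar>"] travel_time_uminus[of c t] travel_time_uminus[of d t] assms
  by (cases "0 \<le> t") (auto simp: abs_minus_commute)

text \<open>
  Joint continuity of the angle in the parameter and the position. The comparison of an angle with
  a fixed \<open>t\<close> is equivalent to a comparison of \<open>travel_time\<close> at \<open>t\<close>, so convergence of the
  travel times at each fixed \<open>t\<close> suffices.
\<close>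

lemma tendsto_angle:
  assumes C: "\<forall>\<^sub>F i in F. C i \<in> {0..1}" "(C \<longlongrightarrow> c) F" "c \<in> {0..1}" and y: "(y \<longlongrightarrow> y0) F"
  shows "((\<lambda>i. angle (C i) (y i)) \<longlongrightarrow> angle c y0) F"
proof -
  have lim: "((\<lambda>i. travel_time (C i) t) \<longlongrightarrow> travel_time c t) F" for t
  proof -
    have "((\<lambda>i. travel_time (C i) t - travel_time c t) \<longlongrightarrow> 0) F"
    proof (rule Lim_null_comparison)
      show "\<forall>\<^sub>F i in F. norm (travel_time (C i) t - travel_time c t) \<le> \<bar>C i - c\<bar> * \<bar>t\<bar>"
        using C(1) by eventually_elim (use travel_time_lipschitz_abs[OF C(3)] in auto)
      have "((\<lambda>i. \<bar>C i - c\<bar> * \<bar>t\<bar>) \<longlongrightarrow> \<bar>c - c\<bar> * \<bar>t\<bar>) F"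
        by (intro tendsto_intros C(2))
      then show "((\<lambda>i. \<bar>C i - c\<bar> * \<bar>t\<bar>) \<longlongrightarrow> 0) F" by simp
    qed
    then show ?thesis by (simp add: LIM_zero_iff)
  qed
  show ?thesis
  proof (rule order_tendstoI)
    fix t assume "t < angle c y0"
    then have "\<forall>\<^sub>F i in F. 0 < y i - travel_time (C i) t"
      by (intro order_tendstoD(1)[OF tendsto_diff[OF y lim]]) (use C(3) in \<open>simp add: less_angle_iff\<close>)
    with C(1) show "\<forall>\<^sub>F i in F. t < angle (C i) (y i)"
      by eventually_elim (simp add: less_angle_iff)
  next
    fix t assume "angle c y0 < t"
    then have "\<forall>\<^sub>F i in F. y i - travel_time (C i) t < 0"
      by (intro order_tendstoD(2)[OF tendsto_diff[OF y lim]]) (use C(3) in \<open>simp add: angle_less_iff\<close>)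
    with C(1) show "\<forall>\<^sub>F i in F. angle (C i) (y i) < t"
      by eventually_elim (simp add: angle_less_iff)
  qed
qed

text \<open>
  The infinite slope of the limit profile. With \<open>t = angle 0 y\<close> the quotient is
  \<open>(sin t / t) / (travel_time 0 t / t)\<close>; the numerator tends to \<open>1\<close> and the denominator to
  \<open>speed 0 0 = 0\<close> through positive values.
\<close>

lemma sin_angle_quotient_at_top: "filterlim (\<lambda>y. sin (angle 0 y) / y) at_top (at 0)"
proof -
  have pos: "0 < travel_time 0 t / t" if "t \<noteq> 0" for t
    using strict_monoD[OF travel_time_strict_mono, of 0 t 0] strict_monoD[OF travel_time_strict_mono, of 0 0 t] that
    by (cases "t < 0") (auto simp: divide_neg_neg)
  have "((\<lambda>t. travel_time 0 t / t) \<longlongrightarrow> 0) (at 0)"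
    using travel_time_deriv[of 0 0] by (simp add: has_field_derivative_iff speed_def slope_cos_def)
  then have "filterlim (\<lambda>t. inverse (travel_time 0 t / t)) at_top (at 0)"
    by (rule filterlim_inverse_at_top) (use pos in \<open>simp add: eventually_at_filter\<close>)
  moreover have "((\<lambda>t. sin t / t) \<longlongrightarrow> (1::real)) (at 0)"
    using DERIV_sin[of "0::real"] by (simp add: has_field_derivative_iff)
  ultimately have "filterlim (\<lambda>t. sin t / t * inverse (travel_time 0 t / t)) at_top (at 0)"
    by (intro filterlim_tendsto_pos_mult_at_top[of _ 1]) auto
  moreover have "filterlim (angle 0) (at 0) (at 0)"
    unfolding filterlim_at
  proof
    show "(angle 0 \<longlongrightarrow> 0) (at 0)"
      using continuous_angle[of 0 0] by (simp add: isCont_def)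
    have "angle 0 y \<noteq> 0" if "y \<noteq> 0" for y
      using that travel_time_angle[of 0 y] by fastforce
    then show "\<forall>\<^sub>F y in at 0. angle 0 y \<in> UNIV \<and> angle 0 y \<noteq> 0"
      by (simp add: eventually_at_filter)
  qed
  ultimately have "filterlim (\<lambda>y. sin (angle 0 y) / angle 0 y * inverse (travel_time 0 (angle 0 y) / angle 0 y)) at_top (at 0)"
    by (rule filterlim_compose)
  then show ?thesis
  proof (rule filterlim_mono_eventually)
    have "angle 0 y \<noteq> 0" if "y \<noteq> 0" for y
      using that travel_time_angle[of 0 y] by fastforce
    then show "\<forall>\<^sub>F y in at 0. sin (angle 0 y) / angle 0 y * inverse (travel_time 0 (angle 0 y) / angle 0 y)
        = sin (angle 0 y) / y"
      by (simp add: eventually_at_filter)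
  qed auto
qed

section \<open>The explicit solutions\<close>

definition amplitude :: "real \<Rightarrow> real \<Rightarrow> real \<Rightarrow> real" where
  "amplitude \<kappa> l c = sqrt (2 * (1 - c) / (\<kappa> * l))"

definition profile :: "real \<Rightarrow> real \<Rightarrow> real \<Rightarrow> real \<Rightarrow> real" where
  "profile \<kappa> l c x = amplitude \<kappa> l c * sin (angle c (sqrt (l / 2) * x))"

text \<open>
  The derivative of the profile as a function of the phase. The formula is regular at the
  extrema, where expressing \<open>u'\<close> through \<open>u\<close> would involve a square root at \<open>0\<close> and a choice of
  sign.
\<close>

definition slope_at :: "real \<Rightarrow> real \<Rightarrow> real \<Rightarrow> real" where
  "slope_at \<kappa> c t = sqrt ((1 - c) / \<kappa>) * (cos t * sqrt (1 + slope_cos c t) / slope_cos c t)"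

lemma amplitude_square: "\<kappa> > 0 \<Longrightarrow> l > 0 \<Longrightarrow> c \<in> {0..1} \<Longrightarrow> \<kappa> * l * (amplitude \<kappa> l c)\<^sup>2 = 2 * (1 - c)"
  by (simp add: amplitude_def)

lemma amplitude_frequency:
  assumes "\<kappa> > 0" "l > 0"
  shows "amplitude \<kappa> l c * sqrt (l / 2) = sqrt ((1 - c) / \<kappa>)"
proof -
  have eq: "2 * (1 - c) / (\<kappa> * l) * (l / 2) = (1 - c) / \<kappa>"
    using assms by (simp add: field_simps)
  show ?thesis
    by (simp only: amplitude_def real_sqrt_mult[symmetric] eq)
qed

lemma slope_cos_profile:
  assumes "\<kappa> > 0" "l > 0" "c \<in> {0..1}"
  shows "slope_cos c (angle c (sqrt (l / 2) * x)) = c + \<kappa> * l * (profile \<kappa> l c x)\<^sup>2 / 2"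
proof -
  have "\<kappa> * l * (profile \<kappa> l c x)\<^sup>2 = 2 * (1 - c) * (sin (angle c (sqrt (l / 2) * x)))\<^sup>2"
    using amplitude_square[OF assms] by (simp add: profile_def power_mult_distrib)
  then show ?thesis
    by (simp add: slope_cos_def)
qed

lemma slope_at_square:
  assumes "\<kappa> > 0" "c \<in> {0..1}" "0 < slope_cos c t"
  shows "1 + \<kappa> * (slope_at \<kappa> c t)\<^sup>2 = 1 / (slope_cos c t)\<^sup>2"
proof -
  define q where "q = slope_cos c t"
  have q: "0 < q" using assms(3) by (simp add: q_def)
  have "\<kappa> * (slope_at \<kappa> c t)\<^sup>2 = ((1 - c) * (cos t)\<^sup>2) * (1 + q) / q\<^sup>2"
    using assms q by (simp add: slope_at_def q_def[symmetric] power_mult_distrib power_divide)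
  also have "\<dots> = (1 - q) * (1 + q) / q\<^sup>2"
    by (simp add: one_minus_slope_cos q_def)
  also have "\<dots> = 1 / q\<^sup>2 - 1"
    using q by (simp add: field_simps power2_eq_square)
  finally show ?thesis by (simp add: q_def)
qed

lemma slope_at_deriv:
  assumes "c \<in> {0..1}" "0 < slope_cos c t"
  shows "(slope_at \<kappa> c has_real_derivative
    sqrt ((1 - c) / \<kappa>) * (- 2 * sin t / ((slope_cos c t)\<^sup>2 * sqrt (1 + slope_cos c t)))) (at t)"
proof -
  define q r where "q = slope_cos c t" and "r = sqrt (1 + slope_cos c t)"
  have q: "0 < q" "0 < r" "r\<^sup>2 = 1 + q" using assms(2) by (simp_all add: q_def r_def)
  have dq: "(slope_cos c has_real_derivative 2 * (1 - c) * sin t * cos t) (at t)"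
    unfolding slope_cos_def[abs_def] by (auto intro!: derivative_eq_intros)
  have cq: "cos t * (2 * (1 - c) * sin t * cos t) = 2 * sin t * (1 - q)"
    using one_minus_slope_cos[of c t] by (simp add: q_def power2_eq_square mult_ac)
  have "((\<lambda>t. sqrt (1 + slope_cos c t)) has_real_derivative (1 - c) * sin t * cos t / r) (at t)"
    using assms(2) by (auto intro!: derivative_eq_intros dq simp: r_def field_simps)
  from DERIV_divide[OF DERIV_mult[OF DERIV_cos this] dq] q
  have "((\<lambda>t. cos t * sqrt (1 + slope_cos c t) / slope_cos c t) has_real_derivative
      ((- sin t * r + (1 - c) * sin t * cos t / r * cos t) * q - cos t * r * (2 * (1 - c) * sin t * cos t)) / (q * q)) (at t)"
    by (simp add: q_def r_def)
  moreover have "((- sin t * r + (1 - c) * sin t * cos t / r * cos t) * q - cos t * r * (2 * (1 - c) * sin t * cos t)) / (q * q)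
      = - 2 * sin t / (q\<^sup>2 * r)"
  proof -
    \<comment> \<open>Clearing the root leaves a polynomial in \<open>q\<close>, once \<open>(1 - c) cos\<^sup>2 t\<close> is replaced by \<open>1 - q\<close>.\<close>
    have "((- sin t * r + (1 - c) * sin t * cos t / r * cos t) * q - cos t * r * (2 * (1 - c) * sin t * cos t)) * r
       = - sin t * q * r\<^sup>2 + (cos t * (2 * (1 - c) * sin t * cos t)) * (q / 2 - r\<^sup>2)"
      using q(2) by (simp add: field_simps power2_eq_square)
    also have "\<dots> = - 2 * sin t"
      unfolding cq q(3) by (simp add: field_simps power2_eq_square)
    finally have "(- sin t * r + (1 - c) * sin t * cos t / r * cos t) * q - cos t * r * (2 * (1 - c) * sin t * cos t)
        = - 2 * sin t / r"
      using q(2) by (simp only: nonzero_eq_divide_eq[OF less_imp_neq[OF q(2), symmetric]])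
    then show ?thesis
      by (simp add: power2_eq_square)
  qed
  ultimately have "((\<lambda>t. cos t * sqrt (1 + slope_cos c t) / slope_cos c t) has_real_derivative
      - 2 * sin t / (q\<^sup>2 * r)) (at t)"
    by simp
  from DERIV_cmult[OF this, of "sqrt ((1 - c) / \<kappa>)"] show ?thesis
    by (simp add: slope_at_def[abs_def] q_def r_def)
qed

text \<open>
  Together with \<open>slope_at_square\<close>, which gives \<open>(1 + \<kappa> u'\<^sup>2) powr (3 / 2) = 1 / q ^ 3\<close>, the second
  part is the differential equation.
\<close>

lemma profile_deriv:
  assumes "\<kappa> > 0" "l > 0" "c \<in> {0..1}" and q: "0 < slope_cos c (angle c (sqrt (l / 2) * x))"
  shows "(profile \<kappa> l c has_real_derivative slope_at \<kappa> c (angle c (sqrt (l / 2) * x))) (at x)"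
    and "((\<lambda>x. slope_at \<kappa> c (angle c (sqrt (l / 2) * x))) has_real_derivative
      - l * profile \<kappa> l c x / (slope_cos c (angle c (sqrt (l / 2) * x))) ^ 3) (at x)"
proof -
  define w where "w = sqrt (l / 2)"
  define t where "t = angle c (w * x)"
  have w: "w * w = l / 2" "amplitude \<kappa> l c * w = sqrt ((1 - c) / \<kappa>)" "0 < w"
    using assms amplitude_frequency[of \<kappa> l c] by (simp_all add: w_def)
  have q: "0 < slope_cos c t" "0 < sqrt (1 + slope_cos c t)"
    using assms(4) by (simp_all add: t_def w_def)
  have dt: "((\<lambda>x. angle c (w * x)) has_real_derivative w * sqrt (1 + slope_cos c t) / slope_cos c t) (at x)"
    using DERIV_chain2[OF angle_deriv DERIV_cmult_Id, of c w x] assms(3) q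
    by (simp add: t_def speed_def mult.commute)
  have "((\<lambda>x. amplitude \<kappa> l c * sin (angle c (w * x))) has_real_derivative
      amplitude \<kappa> l c * (cos t * (w * sqrt (1 + slope_cos c t) / slope_cos c t))) (at x)"
    unfolding t_def by (rule DERIV_cmult[OF DERIV_chain2[OF DERIV_sin dt[unfolded t_def]]])
  moreover have "amplitude \<kappa> l c * (cos t * (w * sqrt (1 + slope_cos c t) / slope_cos c t)) = slope_at \<kappa> c t"
    by (simp add: slope_at_def w(2)[symmetric])
  ultimately show "(profile \<kappa> l c has_real_derivative slope_at \<kappa> c (angle c (sqrt (l / 2) * x))) (at x)"
    by (simp add: profile_def[abs_def] t_def w_def)
  have "((\<lambda>x. slope_at \<kappa> c (angle c (w * x))) has_real_derivative
      sqrt ((1 - c) / \<kappa>) * (- 2 * sin t / ((slope_cos c t)\<^sup>2 * sqrt (1 + slope_cos c t)))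
      * (w * sqrt (1 + slope_cos c t) / slope_cos c t)) (at x)"
    by (rule DERIV_chain2[OF slope_at_deriv[OF assms(3) q(1), unfolded t_def] dt, folded t_def])
  moreover have "sqrt ((1 - c) / \<kappa>) * (- 2 * sin t / ((slope_cos c t)\<^sup>2 * sqrt (1 + slope_cos c t)))
      * (w * sqrt (1 + slope_cos c t) / slope_cos c t) = - 2 * (w * w) * amplitude \<kappa> l c * sin t / slope_cos c t ^ 3"
    using q unfolding w(2)[symmetric] by (simp add: field_simps power2_eq_square power3_eq_cube)
  ultimately show "((\<lambda>x. slope_at \<kappa> c (angle c (sqrt (l / 2) * x))) has_real_derivative
      - l * profile \<kappa> l c x / (slope_cos c (angle c (sqrt (l / 2) * x))) ^ 3) (at x)"
    by (simp add: w(1) profile_def t_def[symmetric] w_def[symmetric] mult.assoc)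
qed

lemma continuous_on_profile:
  assumes "c \<in> {0..1}"
  shows "continuous_on S (profile \<kappa> l c)"
proof -
  have "continuous_on UNIV (angle c)"
    by (simp add: continuous_at_imp_continuous_on continuous_angle[OF assms])
  then have "continuous_on S (\<lambda>x. angle c (sqrt (l / 2) * x))"
    by (rule continuous_on_compose2) (auto intro: continuous_intros)
  then show ?thesis
    unfolding profile_def[abs_def] by (intro continuous_on_mult continuous_on_sin continuous_on_const)
qed

lemma powr_three_halves: "0 < w \<Longrightarrow> w powr (3 / 2) = sqrt w ^ 3" for w :: real
  by (simp add: powr_half_sqrt[symmetric] powr_powr flip: powr_realpow)

text \<open>
  The condition on \<open>at x within S\<close> makes one-sided derivatives unique. It holds both for the
  closed unit interval and for open sets, the two kinds of domain that occur.
\<close>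

lemma C2_onI:
  fixes u u1 u2 :: "real \<Rightarrow> real"
  assumes u: "\<And>x. x \<in> S \<Longrightarrow> (u has_real_derivative u1 x) (at x within S)"
    and u1: "\<And>x. x \<in> S \<Longrightarrow> (u1 has_real_derivative u2 x) (at x within S)"
    and u2: "continuous_on S u2"
    and nontriv: "\<And>x. x \<in> S \<Longrightarrow> at x within S \<noteq> bot"
  shows "C2_on S u"
proof -
  have deriv_on_eq: "deriv_on S f x = g x"
    if "\<And>x. x \<in> S \<Longrightarrow> (f has_real_derivative g x) (at x within S)" "x \<in> S" for f g x
    using that nontriv
    by (simp add: deriv_on_def vector_derivative_within has_real_derivative_iff_has_vector_derivative)
  have C1: "C1_on S f"
    if f: "\<And>x. x \<in> S \<Longrightarrow> (f has_real_derivative g x) (at x within S)" and g: "continuous_on S g" for f g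
    unfolding C1_on_def
  proof
    show "f differentiable_on S"
      using f by (auto simp: differentiable_on_def differentiable_def has_field_derivative_def)
    show "continuous_on S (deriv_on S f)"
      using g deriv_on_eq[OF f] by (simp cong: continuous_on_cong)
  qed
  have "((deriv_on S u) has_real_derivative u2 x) (at x within S)" if "x \<in> S" for x
    by (rule has_field_derivative_transform_within[OF u1[OF that], of 1]) (use that deriv_on_eq[OF u] in auto)
  then show ?thesis
    unfolding C2_on_def using C1[OF u DERIV_continuous_on[OF u1]] C1[OF _ u2] by simp
qed

lemma profile_C2:
  assumes "\<kappa> > 0" "l > 0" "c \<in> {0..1}"
    and pos: "\<And>x. x \<in> S \<Longrightarrow> 0 < slope_cos c (angle c (sqrt (l / 2) * x))"
    and nontriv: "\<And>x. x \<in> S \<Longrightarrow> at x within S \<noteq> bot"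
  shows "C2_on S (\<lambda>x. \<nu> * profile \<kappa> l c x)"
proof (rule C2_onI)
  note d = profile_deriv[OF assms(1-3) pos]
  fix x assume x: "x \<in> S"
  show "((\<lambda>x. \<nu> * profile \<kappa> l c x) has_real_derivative \<nu> * slope_at \<kappa> c (angle c (sqrt (l / 2) * x))) (at x within S)"
    by (intro DERIV_cmult has_field_derivative_at_within[OF d(1)[OF x]])
  show "((\<lambda>x. \<nu> * slope_at \<kappa> c (angle c (sqrt (l / 2) * x))) has_real_derivative
      \<nu> * (- l * profile \<kappa> l c x / (c + \<kappa> * l * (profile \<kappa> l c x)\<^sup>2 / 2) ^ 3)) (at x within S)"
    by (rule DERIV_cmult[OF has_field_derivative_at_within[OF
          d(2)[OF x, unfolded slope_cos_profile[OF assms(1-3)]]]])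
next
  show "continuous_on S (\<lambda>x. \<nu> * (- l * profile \<kappa> l c x / (c + \<kappa> * l * (profile \<kappa> l c x)\<^sup>2 / 2) ^ 3))"
    using pos unfolding slope_cos_profile[OF assms(1-3)]
    by (intro continuous_intros continuous_on_profile[OF assms(3)]) force+
qed (fact nontriv)

lemma profile_equation:
  assumes "\<kappa> > 0" "l > 0" "c \<in> {0..1}" "\<nu> \<in> {1, -1}" "open S"
    and pos: "\<And>x. x \<in> S \<Longrightarrow> 0 < slope_cos c (angle c (sqrt (l / 2) * x))"
  shows "satisfies_equation \<kappa> l S (\<lambda>x. \<nu> * profile \<kappa> l c x)"
  unfolding satisfies_equation_def
proof
  note d = profile_deriv[OF assms(1-3) pos]
  have deriv1: "deriv (\<lambda>x. \<nu> * profile \<kappa> l c x) y = \<nu> * slope_at \<kappa> c (angle c (sqrt (l / 2) * y))"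
    if "y \<in> S" for y
    by (rule DERIV_imp_deriv[OF DERIV_cmult[OF d(1)[OF that]]])
  fix x assume x: "x \<in> S"
  define q where "q = slope_cos c (angle c (sqrt (l / 2) * x))"
  have q: "0 < q" using pos[OF x] by (simp add: q_def)
  have "(deriv (\<lambda>x. \<nu> * profile \<kappa> l c x) has_real_derivative \<nu> * (- l * profile \<kappa> l c x / q ^ 3)) (at x)"
    by (rule has_field_derivative_transform_within_open[OF DERIV_cmult[OF d(2)[OF x, folded q_def]] assms(5) x])
      (simp add: deriv1)
  then have "deriv (deriv (\<lambda>x. \<nu> * profile \<kappa> l c x)) x = \<nu> * (- l * profile \<kappa> l c x / q ^ 3)"
    by (rule DERIV_imp_deriv)
  moreover have "(1 + \<kappa> * (deriv (\<lambda>x. \<nu> * profile \<kappa> l c x) x)\<^sup>2) powr (3 / 2) = 1 / q ^ 3"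
  proof -
    have "\<nu>\<^sup>2 = 1" using assms(4) by auto
    then have "1 + \<kappa> * (deriv (\<lambda>x. \<nu> * profile \<kappa> l c x) x)\<^sup>2 = 1 / q\<^sup>2"
      using slope_at_square[OF assms(1,3) pos[OF x]] by (simp add: deriv1[OF x] power_mult_distrib q_def)
    then show ?thesis
      using q powr_three_halves[of "1 / q\<^sup>2"] by (simp add: real_sqrt_divide power_divide)
  qed
  ultimately show "- deriv (deriv (\<lambda>x. \<nu> * profile \<kappa> l c x)) x =
      l * (\<nu> * profile \<kappa> l c x) * (1 + \<kappa> * (deriv (\<lambda>x. \<nu> * profile \<kappa> l c x) x)\<^sup>2) powr (3 / 2)"
    by simp
qed

lemma amplitude_pos: "\<kappa> > 0 \<Longrightarrow> l > 0 \<Longrightarrow> c < 1 \<Longrightarrow> 0 < amplitude \<kappa> l c"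
  by (simp add: amplitude_def)

text \<open>
  The sine vanishes at the multiples of \<open>pi\<close>, which \<^term>\<open>travel_time c\<close> maps to the even
  multiples of the quarter period.
\<close>

lemma profile_eq_0_iff:
  assumes "\<kappa> > 0" "l > 0" "c \<in> {0..<1}"
  shows "profile \<kappa> l c x = 0 \<longleftrightarrow> (\<exists>j::int. sqrt (l / 2) * x = 2 * of_int j * quarter c)"
proof -
  have c: "c \<in> {0..1}" using assms(3) by auto
  have "profile \<kappa> l c x = 0 \<longleftrightarrow> (\<exists>j::int. angle c (sqrt (l / 2) * x) = of_int j * pi)"
    using amplitude_pos[of \<kappa> l c] assms by (simp add: profile_def sin_zero_iff_int2)
  also have "\<dots> \<longleftrightarrow> (\<exists>j::int. sqrt (l / 2) * x = 2 * of_int j * quarter c)"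
    by (metis travel_time_int_pi[OF c] angle_travel_time[OF c] travel_time_angle[OF c])
  finally show ?thesis .
qed

section \<open>Uniqueness by the first integral\<close>

text \<open>
  The definition of a classical solution uses derivatives relative to the closed interval and
  iterated two-sided derivatives in its interior; here they are reduced to one function.
\<close>

lemma classical_solution_derivs:
  assumes "classical_solution \<kappa> l u"
  defines "u1 \<equiv> deriv_on {0..1} u"
  shows "\<And>x. x \<in> {0..1} \<Longrightarrow> (u has_real_derivative u1 x) (at x within {0..1})"
    and "continuous_on {0..1} u" "continuous_on {0..1} u1"
    and "\<And>x. x \<in> {0<..<1} \<Longrightarrow> (u has_real_derivative u1 x) (at x)"
    and "\<And>x. x \<in> {0<..<1} \<Longrightarrow>
           (u1 has_real_derivative - l * u x * (1 + \<kappa> * (u1 x)\<^sup>2) powr (3 / 2)) (at x)"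
proof -
  have C2: "C2_on {0..1} u" and eq: "satisfies_equation \<kappa> l {0<..<1} u"
    using assms(1) by (auto simp: classical_solution_def)
  have within: "at x within {0..1} = at x" if "x \<in> {0<..<1}" for x :: real
    using that by (intro at_within_interior) auto
  have der: "(f has_real_derivative deriv_on {0..1} f x) (at x within {0..1})"
    if "C1_on {0..1} f" "x \<in> {0..1}" for f x
    using that by (auto simp: C1_on_def differentiable_on_def deriv_on_def
        has_real_derivative_iff_has_vector_derivative vector_derivative_works[symmetric])
  show d1: "(u has_real_derivative u1 x) (at x within {0..1})" if "x \<in> {0..1}" for x
    using C2 that der[of u x] by (auto simp: C2_on_def u1_def)
  then show "continuous_on {0..1} u"
    by (rule DERIV_continuous_on)
  show "continuous_on {0..1} u1"
    using C2 by (auto simp: C2_on_def C1_on_def u1_def)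
  show d1': "(u has_real_derivative u1 x) (at x)" if "x \<in> {0<..<1}" for x
    using d1[of x] that within by auto
  show "(u1 has_real_derivative - l * u x * (1 + \<kappa> * (u1 x)\<^sup>2) powr (3 / 2)) (at x)" if x: "x \<in> {0<..<1}" for x
  proof -
    have d2: "(u1 has_real_derivative deriv_on {0..1} u1 x) (at x)"
      using C2 x der[of u1 x] within[OF x] by (auto simp: C2_on_def u1_def)
    have deriv_u: "deriv u y = u1 y" if "y \<in> {0<..<1}" for y
      by (rule DERIV_imp_deriv[OF d1'[OF that]])
    have "(deriv u has_real_derivative deriv_on {0..1} u1 x) (at x)"
      by (rule has_field_derivative_transform_within_open[OF d2, of "{0<..<1}"]) (use x deriv_u in auto)
    then have "deriv (deriv u) x = deriv_on {0..1} u1 x"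
      by (rule DERIV_imp_deriv)
    moreover have "- deriv (deriv u) x = l * u x * (1 + \<kappa> * (u1 x)\<^sup>2) powr (3 / 2)"
      using eq x deriv_u[OF x] by (auto simp: satisfies_equation_def)
    ultimately have "deriv_on {0..1} u1 x = - l * u x * (1 + \<kappa> * (u1 x)\<^sup>2) powr (3 / 2)"
      by simp
    with d2 show ?thesis by simp
  qed
qed

text \<open>
  Multiplying the equation by \<open>u'\<close> and dividing by \<open>(1 + \<kappa> u'\<^sup>2) powr (3 / 2)\<close> makes both sides
  exact derivatives. The identity holds for every real \<open>l\<close> and later serves to exclude \<open>l \<le> 0\<close>.
\<close>

lemma first_integral:
  assumes "\<kappa> > 0" and sol: "classical_solution \<kappa> l u" and x: "x \<in> {0..1}"
  defines "u1 \<equiv> deriv_on {0..1} u"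
  shows "1 / sqrt (1 + \<kappa> * (u1 x)\<^sup>2) = 1 / sqrt (1 + \<kappa> * (u1 0)\<^sup>2) + \<kappa> * l * (u x)\<^sup>2 / 2"
proof -
  note d = classical_solution_derivs[OF sol, folded u1_def]
  define e where "e x = 1 / sqrt (1 + \<kappa> * (u1 x)\<^sup>2) - \<kappa> * l * (u x)\<^sup>2 / 2" for x
  have pos: "0 < 1 + \<kappa> * (u1 x)\<^sup>2" for x
    using assms(1) by (simp add: add_pos_nonneg)
  have "e x = e 0"
  proof (rule DERIV_isconst2[of 0 1])
    show "continuous_on {0..1} e"
      unfolding e_def using pos by (intro continuous_intros d(2,3)) (auto simp: less_imp_neq[symmetric])
    fix x :: real assume "0 < x" "x < 1"
    then have x: "x \<in> {0<..<1}" by simp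
    define r where "r = sqrt (1 + \<kappa> * (u1 x)\<^sup>2)"
    have r: "0 < r" using pos by (simp add: r_def)
    have d2: "(u1 has_real_derivative - l * u x * r ^ 3) (at x)"
      using d(5)[OF x] powr_three_halves[OF pos] by (simp add: r_def)
    have "((\<lambda>x. sqrt (1 + \<kappa> * (u1 x)\<^sup>2)) has_real_derivative - \<kappa> * l * u1 x * u x * r\<^sup>2) (at x)"
    proof -
      have "((\<lambda>x. 1 + \<kappa> * (u1 x)\<^sup>2) has_real_derivative \<kappa> * (2 * u1 x * (- l * u x * r ^ 3))) (at x)"
        by (auto intro!: derivative_eq_intros d2)
      from DERIV_chain2[OF DERIV_real_sqrt[OF pos] this] show ?thesis
        unfolding r_def[symmetric] using r by (simp add: field_simps power2_eq_square power3_eq_cube)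
    qed
    from DERIV_divide[OF DERIV_const[of 1] this, folded r_def] r
    have "((\<lambda>x. 1 / sqrt (1 + \<kappa> * (u1 x)\<^sup>2)) has_real_derivative \<kappa> * l * u1 x * u x) (at x)"
      by (simp add: power2_eq_square)
    moreover have "((\<lambda>x. \<kappa> * l * (u x)\<^sup>2 / 2) has_real_derivative \<kappa> * l * u1 x * u x) (at x)"
      by (auto intro!: derivative_eq_intros d(4)[OF x] simp: field_simps)
    ultimately show "(e has_real_derivative 0) (at x)"
      unfolding e_def using DERIV_diff by fastforce
  qed (use x in auto)
  moreover have "u 0 = 0"
    using sol by (simp add: classical_solution_def)
  ultimately show ?thesis
    by (simp add: e_def)
qed

text \<open>
  Gronwall's argument: the squared distance of the two trajectories in the phase plane, damped by
  \<open>exp (- (1 + L) x)\<close>, is nonincreasing.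
\<close>

lemma second_order_uniqueness:
  fixes u v u1 v1 H :: "real \<Rightarrow> real"
  assumes cont: "continuous_on {a..b} u" "continuous_on {a..b} v" "continuous_on {a..b} u1" "continuous_on {a..b} v1"
    and du: "\<And>x. x \<in> {a<..<b} \<Longrightarrow> (u has_real_derivative u1 x) (at x)"
    and dv: "\<And>x. x \<in> {a<..<b} \<Longrightarrow> (v has_real_derivative v1 x) (at x)"
    and du1: "\<And>x. x \<in> {a<..<b} \<Longrightarrow> (u1 has_real_derivative H (u x)) (at x)"
    and dv1: "\<And>x. x \<in> {a<..<b} \<Longrightarrow> (v1 has_real_derivative H (v x)) (at x)"
    and lip: "\<And>y z. \<bar>H y - H z\<bar> \<le> L * \<bar>y - z\<bar>"
    and init: "u a = v a" "u1 a = v1 a" and x: "x \<in> {a..b}"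
  shows "u x = v x"
proof -
  define e where "e x = ((u x - v x)\<^sup>2 + (u1 x - v1 x)\<^sup>2) * exp (- (1 + L) * x)" for x
  have "e x \<le> e a"
  proof (rule DERIV_nonpos_imp_decreasing_open[where f = e])
    show "continuous_on {a..x} e"
      unfolding e_def using x
      by (intro continuous_intros continuous_on_subset[OF cont(1)] continuous_on_subset[OF cont(2)]
          continuous_on_subset[OF cont(3)] continuous_on_subset[OF cont(4)]) auto
    fix y assume "a < y" "y < x"
    then have y: "y \<in> {a<..<b}" using x by auto
    define p q h where "p = u y - v y" and "q = u1 y - v1 y" and "h = H (u y) - H (v y)"
    have dE: "(e has_real_derivative (2 * p * q + 2 * q * h - (1 + L) * (p\<^sup>2 + q\<^sup>2)) * exp (- (1 + L) * y)) (at y)"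
      unfolding e_def
      by (rule derivative_eq_intros du[OF y] dv[OF y] du1[OF y] dv1[OF y] refl)+
        (simp add: p_def q_def h_def algebra_simps)
    have "2 * p * q + 2 * q * h \<le> (1 + L) * (p\<^sup>2 + q\<^sup>2)"
    proof -
      have L: "0 \<le> L" using lip[of 1 0] by simp
      have pq: "2 * \<bar>p\<bar> * \<bar>q\<bar> \<le> p\<^sup>2 + q\<^sup>2"
        using sum_squares_bound[of "\<bar>p\<bar>" "\<bar>q\<bar>"] by simp
      have "2 * q * h \<le> 2 * \<bar>q\<bar> * \<bar>h\<bar>"
        by (metis abs_ge_self abs_mult abs_numeral)
      also have "\<dots> \<le> 2 * \<bar>q\<bar> * (L * \<bar>p\<bar>)"
        using lip[of "u y" "v y"] by (intro mult_left_mono) (auto simp: p_def h_def)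
      also have "\<dots> \<le> L * (p\<^sup>2 + q\<^sup>2)"
        using mult_left_mono[OF pq L] by (simp add: mult_ac)
      finally have "2 * q * h \<le> L * (p\<^sup>2 + q\<^sup>2)" .
      moreover have "2 * p * q \<le> 2 * \<bar>p\<bar> * \<bar>q\<bar>"
        by (metis abs_ge_self abs_mult abs_numeral)
      ultimately show ?thesis
        using pq by (simp add: distrib_right)
    qed
    then have "(2 * p * q + 2 * q * h - (1 + L) * (p\<^sup>2 + q\<^sup>2)) * exp (- (1 + L) * y) \<le> 0"
      by (simp add: mult_nonpos_nonneg)
    with dE show "\<exists>d. (e has_real_derivative d) (at y) \<and> d \<le> 0"
      by blast
  qed (use x in auto)
  also have "e a = 0"
    by (simp add: e_def init)
  finally have "(u x - v x)\<^sup>2 + (u1 x - v1 x)\<^sup>2 \<le> 0"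
    by (simp add: e_def mult_le_0_iff not_le)
  then show ?thesis
    by (simp add: sum_power2_le_zero_iff)
qed

text \<open>
  With \<open>q = c + k y\<^sup>2 / 2\<close> the derivative is \<open>l (6 s - 1) / q\<^sup>3\<close>, where \<open>s = (k y\<^sup>2 / 2) / q\<close> lies
  between \<open>0\<close> and \<open>1\<close>, and \<open>q \<ge> c\<close>. This is where positivity of \<open>c\<close> enters.
\<close>

lemma force_lipschitz:
  fixes c k l y z :: real
  assumes "c > 0" "k > 0" "l > 0"
  shows "\<bar>(- l * y / (c + k * y\<^sup>2 / 2) ^ 3) - (- l * z / (c + k * z\<^sup>2 / 2) ^ 3)\<bar> \<le> 7 * l / c ^ 3 * \<bar>y - z\<bar>"
proof -
  define H where "H y = - l * y / (c + k * y\<^sup>2 / 2) ^ 3" for y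
  define H' where "H' y = (- l + 6 * l * ((k * y\<^sup>2 / 2) / (c + k * y\<^sup>2 / 2))) / (c + k * y\<^sup>2 / 2) ^ 3" for y
  have q: "0 < c + k * y\<^sup>2 / 2" "c \<le> c + k * y\<^sup>2 / 2" for y
    using assms by (auto intro: add_pos_nonneg)
  have der: "(H has_real_derivative H' y) (at y within UNIV)" for y
  proof -
    define q where "q = c + k * y\<^sup>2 / 2"
    have "q > 0" using q[of y] by (simp add: q_def)
    have "((\<lambda>y. c + k * y\<^sup>2 / 2) has_real_derivative k * y) (at y)"
      by (auto intro!: derivative_eq_intros)
    from DERIV_divide[OF DERIV_cmult_Id DERIV_power[OF this, of 3], of "- l"] \<open>q > 0\<close>
    have "(H has_real_derivative (- l * q ^ 3 - - l * y * (3 * (k * y * q\<^sup>2))) / (q ^ 3 * q ^ 3)) (at y)"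
      unfolding H_def by (simp add: q_def)
    also have "(- l * q ^ 3 - - l * y * (3 * (k * y * q\<^sup>2))) / (q ^ 3 * q ^ 3) = H' y"
    proof -
      have "3 * k * y\<^sup>2 = 6 * ((k * y\<^sup>2 / 2) / q) * q"
        using \<open>q > 0\<close> by simp
      then have "- l * q ^ 3 - - l * y * (3 * (k * y * q\<^sup>2)) = (- l + 6 * l * ((k * y\<^sup>2 / 2) / q)) * q ^ 3"
        by (simp add: algebra_simps power2_eq_square power3_eq_cube)
      moreover have "z * r / (r * r) = z / r" if "r \<noteq> 0" for z r :: real
        using that by simp
      ultimately show ?thesis
        unfolding H'_def q_def[symmetric] using \<open>q > 0\<close> by (metis zero_less_power less_irrefl)
    qed
    finally show ?thesis by simp
  qed
  have "norm (H' y) \<le> 7 * l / c ^ 3" for y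
  proof -
    define s where "s = (k * y\<^sup>2 / 2) / (c + k * y\<^sup>2 / 2)"
    have s: "0 \<le> s" "s \<le> 1" using assms q(1)[of y] by (auto simp: s_def)
    have "0 \<le> l * s" "l * s \<le> l" using s assms by (auto simp: mult_left_le)
    then have "\<bar>- l + 6 * l * s\<bar> \<le> 7 * l" using assms by (simp add: abs_le_iff)
    moreover have "c ^ 3 \<le> (c + k * y\<^sup>2 / 2) ^ 3" using q[of y] assms by (intro power_mono) auto
    ultimately have "\<bar>- l + 6 * l * s\<bar> / (c + k * y\<^sup>2 / 2) ^ 3 \<le> 7 * l / c ^ 3"
      using assms by (intro frac_le) auto
    moreover have "norm (H' y) = \<bar>- l + 6 * l * s\<bar> / (c + k * y\<^sup>2 / 2) ^ 3"
      unfolding H'_def s_def[symmetric] using q(1)[of y] by (simp add: abs_divide)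
    ultimately show ?thesis
      by simp
  qed
  from field_differentiable_bound[OF convex_UNIV der this, of y z] show ?thesis
    by (simp add: H_def)
qed

text \<open>
  At a maximum point \<open>m\<close> of \<open>\<bar>u\<bar>\<close> the first integral reads \<open>1 = c + \<kappa> l (u m)\<^sup>2 / 2\<close> with \<open>c \<le> 1\<close>,
  so \<open>l \<ge> 0\<close>. For \<open>l = 0\<close> it would follow that \<open>u' = 0\<close> everywhere. Once \<open>l > 0\<close>, the same
  equation gives \<open>c < 1\<close>, that is, a nonzero boundary slope.
\<close>

lemma nonzero_solution_parameters:
  assumes "\<kappa> > 0" and sol: "classical_solution \<kappa> l u" and nonzero: "x0 \<in> {0..1}" "u x0 \<noteq> 0"
  shows "0 < l" "deriv_on {0..1} u 0 \<noteq> 0"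
proof -
  define u1 where "u1 = deriv_on {0..1} u"
  note d = classical_solution_derivs[OF sol, folded u1_def]
  note energy = first_integral[OF assms(1) sol, folded u1_def]
  have bc: "u 0 = 0" "u 1 = 0" using sol by (auto simp: classical_solution_def)
  define c where "c = 1 / sqrt (1 + \<kappa> * (u1 0)\<^sup>2)"
  have c: "c \<le> 1" using assms(1) by (simp add: c_def divide_le_eq)
  have "continuous_on {0..1} (\<lambda>x. (u x)\<^sup>2)"
    by (intro continuous_intros d(2))
  from continuous_attains_sup[OF compact_Icc _ this]
  obtain m where m: "m \<in> {0..1}" "\<And>x. x \<in> {0..1} \<Longrightarrow> (u x)\<^sup>2 \<le> (u m)\<^sup>2" by auto
  have um: "u m \<noteq> 0"
    using m(2)[OF nonzero(1)] nonzero(2) by (auto simp: power2_less_eq_zero_iff)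
  then have m01: "m \<in> {0<..<1}"
    using m(1) bc by (cases "m = 0"; cases "m = 1") auto
  have "2 * u m * u1 m = 0"
  proof (rule DERIV_local_max)
    show "((\<lambda>x. (u x)\<^sup>2) has_real_derivative 2 * u m * u1 m) (at m)"
      by (auto intro!: derivative_eq_intros d(4)[OF m01])
    show "0 < min m (1 - m)" using m01 by auto
    show "\<forall>y. \<bar>m - y\<bar> < min m (1 - m) \<longrightarrow> (u y)\<^sup>2 \<le> (u m)\<^sup>2"
      using m(2) by (auto simp: abs_if split: if_splits)
  qed
  then have "u1 m = 0" using um by simp
  then have em: "1 = c + \<kappa> * l * (u m)\<^sup>2 / 2"
    using energy[OF m(1)] by (simp add: c_def)
  have "l \<noteq> 0"
  proof
    assume "l = 0"
    with em have "c = 1" by simp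
    have "u1 x = 0" if "x \<in> {0..1}" for x
      using energy[OF that] \<open>c = 1\<close> \<open>l = 0\<close> assms(1) by (simp add: c_def)
    then have "u m = u 0"
      using DERIV_isconst2[of 0 1 u m] d(2,4) m(1) by force
    with um bc show False by simp
  qed
  moreover have "0 \<le> l"
  proof (rule ccontr)
    assume "\<not> 0 \<le> l"
    then have "\<kappa> * l * (u m)\<^sup>2 < 0" using assms(1) um by (simp add: mult_neg_pos mult_pos_neg)
    with em c show False by simp
  qed
  ultimately show "0 < l" by simp
  then have "c \<noteq> 1" using em um assms(1) by auto
  then show "deriv_on {0..1} u 0 \<noteq> 0" by (auto simp: c_def u1_def)
qed

lemma slope_at_0:
  assumes "\<kappa> > 0" "c \<in> {0<..<1}"
  shows "0 < slope_at \<kappa> c 0" "1 + \<kappa> * (slope_at \<kappa> c 0)\<^sup>2 = 1 / c\<^sup>2"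
proof -
  have q: "slope_cos c 0 = c" by (simp add: slope_cos_def)
  show "0 < slope_at \<kappa> c 0"
    using assms by (simp add: slope_at_def q)
  show "1 + \<kappa> * (slope_at \<kappa> c 0)\<^sup>2 = 1 / c\<^sup>2"
    using slope_at_square[of \<kappa> c 0] assms by (simp add: q)
qed

text \<open>
  The parameter is read off from the boundary slope. The solution and the profile then have the
  same initial data and the same first integral, and both satisfy the second-order equation with
  the Lipschitz force above.
\<close>

lemma classical_solution_profile:
  assumes "\<kappa> > 0" "\<nu> \<in> {1, -1}" and sol: "classical_solution \<kappa> l u"
    and pos: "\<forall>\<^sub>F x in at_right 0. 0 < \<nu> * u x"
  obtains c where "c \<in> {0<..<1}" "0 < l" "\<nu> * deriv_on {0..1} u 0 = slope_at \<kappa> c 0"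
    "\<forall>x\<in>{0..1}. u x = \<nu> * profile \<kappa> l c x"
proof -
  define u1 where "u1 = deriv_on {0..1} u"
  note d = classical_solution_derivs[OF sol, folded u1_def]
  note energy = first_integral[OF assms(1) sol, folded u1_def]
  have u0: "u 0 = 0" using sol by (simp add: classical_solution_def)
  have nu: "\<nu> * \<nu> = 1" "\<nu>\<^sup>2 = 1" using assms(2) by auto
  have "\<forall>\<^sub>F x in at_right 0. 0 < \<nu> * u x \<and> x \<in> {0<..<1}"
    using pos eventually_at_right_real[of 0 1] by (simp add: eventually_conj_iff)
  from eventually_happens'[OF trivial_limit_at_right_real this]
  obtain x0 where "0 < \<nu> * u x0" "x0 \<in> {0<..<1}"
    by blast
  then have "x0 \<in> {0..1}" "u x0 \<noteq> 0"
    by auto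
  note par = nonzero_solution_parameters[OF assms(1) sol this, folded u1_def]
  define c where "c = 1 / sqrt (1 + \<kappa> * (u1 0)\<^sup>2)"
  have W: "1 < 1 + \<kappa> * (u1 0)\<^sup>2" using assms(1) par by simp
  then have "1 < sqrt (1 + \<kappa> * (u1 0)\<^sup>2)" by simp
  then have c: "c \<in> {0<..<1}" by (auto simp: c_def)
  have c01: "c \<in> {0..1}" using c by auto
  have "0 \<le> \<nu> * u1 0"
  proof (rule tendsto_lowerbound)
    have "((\<lambda>x. (u x - u 0) / (x - 0)) \<longlongrightarrow> u1 0) (at_right 0)"
      using d(1)[of 0] by (simp add: has_field_derivative_iff at_within_Icc_at_right)
    then show "((\<lambda>x. \<nu> * ((u x - u 0) / (x - 0))) \<longlongrightarrow> \<nu> * u1 0) (at_right 0)"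
      by (intro tendsto_intros)
    show "\<forall>\<^sub>F x in at_right 0. 0 \<le> \<nu> * ((u x - u 0) / (x - 0))"
      using pos eventually_at_right_less[of "0::real"]
      by eventually_elim (auto simp: u0 zero_le_divide_iff zero_le_mult_iff zero_less_mult_iff)
  qed simp
  moreover have "(slope_at \<kappa> c 0)\<^sup>2 = (\<nu> * u1 0)\<^sup>2"
  proof -
    have "1 / c\<^sup>2 = 1 + \<kappa> * (u1 0)\<^sup>2"
      using W by (simp add: c_def power_divide)
    then show ?thesis
      using slope_at_0(2)[OF assms(1) c] assms(1) nu by (simp add: power_mult_distrib)
  qed
  ultimately have slope: "\<nu> * u1 0 = slope_at \<kappa> c 0"
    using slope_at_0(1)[OF assms(1) c] by (simp add: power2_eq_iff_nonneg)
  define H where "H y = - l * y / (c + (\<kappa> * l) * y\<^sup>2 / 2) ^ 3" for y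
  have q: "0 < slope_cos c t" for t
    using slope_cos_bounds(1)[OF c01, of t] c by auto
  note dp = profile_deriv[OF assms(1) par(1) c01 q]
  have "u x = \<nu> * profile \<kappa> l c x" if x: "x \<in> {0..1}" for x
  proof (rule second_order_uniqueness[where H = H and u = u and ?u1.0 = u1 and v = "\<lambda>x. \<nu> * profile \<kappa> l c x"
        and ?v1.0 = "\<lambda>x. \<nu> * slope_at \<kappa> c (angle c (sqrt (l / 2) * x))" and a = 0 and b = 1])
    show "continuous_on {0..1} u" "continuous_on {0..1} u1" by (fact d)+
    show "continuous_on {0..1} (\<lambda>x. \<nu> * profile \<kappa> l c x)"
      by (intro continuous_intros continuous_on_profile c01)
    show "continuous_on {0..1} (\<lambda>x. \<nu> * slope_at \<kappa> c (angle c (sqrt (l / 2) * x)))"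
      by (intro continuous_intros DERIV_continuous_on[OF has_field_derivative_at_within[OF dp(2)]])
    show "u 0 = \<nu> * profile \<kappa> l c 0"
      using u0 c01 by (simp add: profile_def)
    show "u1 0 = \<nu> * slope_at \<kappa> c (angle c (sqrt (l / 2) * 0))"
      using slope[symmetric] nu c01 by (simp flip: mult.assoc)
    show "\<bar>H y - H z\<bar> \<le> 7 * l / c ^ 3 * \<bar>y - z\<bar>" for y z
      unfolding H_def using force_lipschitz[of c "\<kappa> * l" l y z] assms(1) par c by simp
    show "x \<in> {0..1}" by fact
    fix y :: real assume y: "y \<in> {0<..<1}"
    show "(u has_real_derivative u1 y) (at y)" by (rule d(4)[OF y])
    show "((\<lambda>x. \<nu> * profile \<kappa> l c x) has_real_derivative \<nu> * slope_at \<kappa> c (angle c (sqrt (l / 2) * y))) (at y)"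
      by (rule DERIV_cmult[OF dp(1)])
    have "H (\<nu> * profile \<kappa> l c y) = \<nu> * (- l * profile \<kappa> l c y / slope_cos c (angle c (sqrt (l / 2) * y)) ^ 3)"
      using nu by (simp add: H_def slope_cos_profile[OF assms(1) par(1) c01] power_mult_distrib)
    then show "((\<lambda>x. \<nu> * slope_at \<kappa> c (angle c (sqrt (l / 2) * x))) has_real_derivative H (\<nu> * profile \<kappa> l c y)) (at y)"
      using DERIV_cmult[OF dp(2)] by simp
    define r where "r = sqrt (1 + \<kappa> * (u1 y)\<^sup>2)"
    have "0 < 1 + \<kappa> * (u1 y)\<^sup>2" using assms(1) by (simp add: add_pos_nonneg)
    then have r: "0 < r" "(1 + \<kappa> * (u1 y)\<^sup>2) powr (3 / 2) = r ^ 3"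
      by (simp_all add: r_def powr_three_halves)
    have "1 / r = c + \<kappa> * l * (u y)\<^sup>2 / 2"
      using energy[of y] y by (simp add: c_def r_def)
    then have "H (u y) = - l * u y * r ^ 3"
      using r by (simp add: H_def power_divide flip: \<open>1 / r = _\<close>)
    then show "(u1 has_real_derivative H (u y)) (at y)"
      using d(5)[OF y] r by simp
  qed
  with that c par slope show ?thesis
    by (simp add: u1_def)
qed

section \<open>Solutions with prescribed zeros\<close>

text \<open>
  The last assumption says that \<open>1/n\<close> is the distance between neighbouring zeros of the profile. The
  value \<open>c = 0\<close> is included because the singular limit has the same zeros and symmetries.
\<close>

locale tuned_profile =
  fixes \<kappa> l c \<nu> :: real and n :: nat
  assumes kappa: "0 < \<kappa>" and l: "0 < l" and c: "c \<in> {0..<1}" and n: "1 \<le> n" and nu: "\<nu> \<in> {1, -1}"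
    and frequency: "sqrt (l / 2) = 2 * real n * quarter c"
begin

definition U :: "real \<Rightarrow> real" where
  "U x = \<nu> * profile \<kappa> l c x"

lemma c01: "c \<in> {0..1}"
  using c by auto

lemma nu_nonzero [simp]: "\<nu> \<noteq> 0" "\<nu> * \<nu> = 1" "\<bar>\<nu>\<bar> = 1"
  using nu by auto

lemma U_eq_0_iff: "U x = 0 \<longleftrightarrow> (\<exists>j::int. x = of_int j / real n)"
proof -
  have "sqrt (l / 2) * x = 2 * of_int j * quarter c \<longleftrightarrow> x = of_int j / real n" for j :: int
    using quarter_pos[OF c01] n by (auto simp: frequency field_simps)
  then show ?thesis
    by (simp add: U_def profile_eq_0_iff[OF kappa l c])
qed

lemma U_shift: "U (x + of_int j / real n) = (if even j then 1 else - 1) * U x"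
proof -
  have "sqrt (l / 2) * (x + of_int j / real n) = sqrt (l / 2) * x + 2 * of_int j * quarter c"
    using n by (simp add: frequency field_simps)
  then have "angle c (sqrt (l / 2) * (x + of_int j / real n)) = angle c (sqrt (l / 2) * x) + of_int j * pi"
    by (simp add: angle_add_int[OF c01])
  then show ?thesis
    using sin_npi_int[of j] cos_npi_int[of j] by (simp add: U_def profile_def sin_add mult.commute)
qed

lemma U_reflect: "U (1 / real n - x) = U x"
proof -
  have "sqrt (l / 2) * (1 / real n - x) = - (sqrt (l / 2) * x) + 2 * of_int 1 * quarter c"
    using n by (simp add: frequency field_simps)
  then have "angle c (sqrt (l / 2) * (1 / real n - x)) = pi - angle c (sqrt (l / 2) * x)"
    using angle_add_int[OF c01, of "- (sqrt (l / 2) * x)" 1] by (simp add: angle_uminus[OF c01])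
  then show ?thesis
    by (simp add: U_def profile_def)
qed

lemma U_pos:
  assumes "0 < x" "x < 1 / real n"
  shows "0 < \<nu> * U x"
proof -
  have "0 < angle c (sqrt (l / 2) * x)"
    using assms l by (simp add: less_angle_iff[OF c01])
  moreover have "angle c (sqrt (l / 2) * x) < pi"
    using assms n quarter_pos[OF c01] travel_time_int_pi[OF c01, of 1]
    by (simp add: angle_less_iff[OF c01] frequency field_simps)
  ultimately have "0 < profile \<kappa> l c x"
    using amplitude_pos[OF kappa l] c by (simp add: profile_def sin_gt_zero)
  then show ?thesis
    by (simp add: U_def flip: mult.assoc)
qed

lemma U_zeros: "{x \<in> {0<..<1}. U x = 0} = (\<lambda>j. real j / real n) ` {1..<n}"
proof (intro equalityI subsetI)
  fix x assume "x \<in> {x \<in> {0<..<1}. U x = 0}"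
  then obtain j :: int where j: "x = of_int j / real n" "0 < x" "x < 1"
    by (auto simp: U_eq_0_iff)
  have jn: "real_of_int j = x * real n"
    using j(1) n by simp
  have "0 < real_of_int j" "real_of_int j < real n"
    unfolding jn using j(2,3) n by (auto simp: mult_less_cancel_right1)
  then have "0 < j" "j < int n"
    by linarith+
  then show "x \<in> (\<lambda>j. real j / real n) ` {1..<n}"
    using j(1) by (intro image_eqI[of _ _ "nat j"]) auto
next
  fix x assume "x \<in> (\<lambda>j. real j / real n) ` {1..<n}"
  then obtain j where "j \<in> {1..<n}" "x = of_int (int j) / real n"
    by auto
  then show "x \<in> {x \<in> {0<..<1}. U x = 0}"
    unfolding U_eq_0_iff by (auto simp del: of_int_of_nat_eq)
qed

lemma U_zeros_card: "finite {x \<in> {0<..<1}. U x = 0}" "card {x \<in> {0<..<1}. U x = 0} = n - 1"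
proof -
  have "inj_on (\<lambda>j. real j / real n) {1..<n}"
    using n by (auto simp: inj_on_def)
  then show "finite {x \<in> {0<..<1}. U x = 0}" "card {x \<in> {0<..<1}. U x = 0} = n - 1"
    unfolding U_zeros by (simp_all add: card_image)
qed

lemma U_peak: "U (1 / (2 * real n)) = \<nu> * amplitude \<kappa> l c"
proof -
  have 1: "sqrt (l / 2) * (1 / (2 * real n)) = quarter c"
    using n by (simp add: frequency)
  have 2: "angle c (quarter c) = pi / 2"
    using angle_travel_time[OF c01, of "pi / 2"] by (simp only: quarter_def)
  show ?thesis
    unfolding U_def profile_def 1 2 by simp
qed

lemma U_bound: "\<bar>U x\<bar> \<le> amplitude \<kappa> l c"
proof -
  have "0 < amplitude \<kappa> l c"
    using c by (intro amplitude_pos kappa l) auto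
  then show ?thesis
    by (simp add: U_def profile_def abs_mult)
qed

lemma continuous_U: "continuous_on S U"
  unfolding U_def[abs_def] by (intro continuous_intros continuous_on_profile c01)

lemma sup_norm_eq:
  assumes "\<And>x. x \<in> {0..1} \<Longrightarrow> v x = U x"
  shows "sup_norm v = amplitude \<kappa> l c"
  unfolding sup_norm_def
proof (rule cSup_eq_maximum)
  have peak: "1 / (2 * real n) \<in> {0..1}"
    using n by (auto simp: field_simps)
  have "0 < amplitude \<kappa> l c"
    using c by (intro amplitude_pos kappa l) auto
  then have "\<bar>v (1 / (2 * real n))\<bar> = amplitude \<kappa> l c"
    unfolding assms[OF peak] U_peak by (simp add: abs_mult)
  with peak show "amplitude \<kappa> l c \<in> (\<lambda>x. \<bar>v x\<bar>) ` {0..1}"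
    by (metis image_eqI)
qed (use assms U_bound in auto)

lemma S_solution_U:
  assumes "0 < c"
  shows "S_solution \<kappa> n \<nu> l U"
proof -
  have q: "0 < slope_cos c t" for t
    using slope_cos_bounds(1)[OF c01, of t] assms by auto
  have C2: "C2_on {0..1} U"
    unfolding U_def[abs_def]
    by (rule profile_C2[OF kappa l c01 q]) (simp add: trivial_limit_within islimpt_Icc)
  have eq: "satisfies_equation \<kappa> l {0<..<1} U"
    unfolding U_def[abs_def] by (rule profile_equation[OF kappa l c01 nu _ q]) simp
  have bc: "U 0 = 0" "U 1 = 0"
    unfolding U_eq_0_iff using n by (auto intro: exI[of _ "0::int"] exI[of _ "int n"])
  have "deriv U x \<noteq> 0" if "U x = 0" for x
  proof -
    have "profile \<kappa> l c x = 0" using that by (simp add: U_def)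
    then have "slope_cos c (angle c (sqrt (l / 2) * x)) = c"
      by (simp add: slope_cos_profile[OF kappa l c01])
    then have "1 + \<kappa> * (slope_at \<kappa> c (angle c (sqrt (l / 2) * x)))\<^sup>2 = 1 / c\<^sup>2"
      using slope_at_square[OF kappa c01 q] by simp
    moreover have "1 / c\<^sup>2 \<noteq> 1"
      using assms c by (simp add: power2_eq_1_iff)
    ultimately have "slope_at \<kappa> c (angle c (sqrt (l / 2) * x)) \<noteq> 0"
      by auto
    moreover have "deriv U x = \<nu> * slope_at \<kappa> c (angle c (sqrt (l / 2) * x))"
      unfolding U_def[abs_def] by (rule DERIV_imp_deriv[OF DERIV_cmult[OF profile_deriv(1)[OF kappa l c01 q]]])
    ultimately show ?thesis by simp
  qed
  then have "simple_zeros U = {x \<in> {0<..<1}. U x = 0}"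
    by (auto simp: simple_zeros_def)
  moreover have "\<forall>\<^sub>F x in at_right 0. 0 < \<nu> * U x"
    using eventually_at_right_real[of 0 "1 / real n"] n
    by (auto elim!: eventually_mono intro: U_pos)
  ultimately show ?thesis
    using C2 eq bc U_zeros_card
    by (auto simp: S_solution_def classical_solution_def S_class_def C10_def C2_on_def)
qed

end

context tuned_profile
begin

lemma consecutive_zeros_grid:
  assumes v: "\<And>x. x \<in> {0..1} \<Longrightarrow> v x = U x" and cz: "consecutive_zeros v a b"
  obtains i :: int where "a = of_int i / real n" "b = a + 1 / real n"
proof -
  have ab: "0 \<le> a" "a < b" "b \<le> 1" "U a = 0" "U b = 0" "\<And>x. x \<in> {a<..<b} \<Longrightarrow> U x \<noteq> 0"
    using cz v by (auto simp: consecutive_zeros_def)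
  obtain i k :: int where ik: "a = of_int i / real n" "b = of_int k / real n"
    using ab(4,5) by (auto simp: U_eq_0_iff)
  have next_zero: "U (of_int (i + 1) / real n) = 0"
    unfolding U_eq_0_iff by blast
  have "i < k"
    using ab(2) n unfolding ik by (simp add: divide_less_cancel)
  moreover have "\<not> i + 1 < k"
  proof
    assume "i + 1 < k"
    then have "of_int (i + 1) / real n \<in> {a<..<b}"
      using n unfolding ik by (simp add: divide_less_cancel)
    then show False using ab(6) next_zero by blast
  qed
  ultimately have "k = i + 1" by simp
  then have "b = a + 1 / real n"
    unfolding ik by (simp add: add_divide_distrib)
  with ik(1) that show ?thesis by blast
qed

lemma same_humps:
  assumes v: "\<And>x. x \<in> {0..1} \<Longrightarrow> v x = U x" and G: "G \<in> humps v" and H: "H \<in> humps v"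
  shows "same_hump G H"
proof -
  obtain a b where ab: "consecutive_zeros v a b" "G = hump v a b"
    using G by (auto simp: humps_def)
  obtain i :: int where i: "a = of_int i / real n" "b = a + 1 / real n"
    by (rule consecutive_zeros_grid[OF v ab(1)])
  obtain a' b' where ab': "consecutive_zeros v a' b'" "H = hump v a' b'"
    using H by (auto simp: humps_def)
  obtain j :: int where j: "a' = of_int j / real n" "b' = a' + 1 / real n"
    by (rule consecutive_zeros_grid[OF v ab'(1)])
  define t where "t = of_int (j - i) / real n"
  define s :: real where "s = (if even (j - i) then 1 else - 1)"
  have t: "a' = a + t" "b' = b + t"
    by (simp_all add: i j t_def diff_divide_distrib)
  have vs: "v (x + t) = s * v x" if "x \<in> {a..b}" for x
  proof -
    have "x \<in> {0..1}" "x + t \<in> {0..1}"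
      using that ab(1) ab'(1) t by (auto simp: consecutive_zeros_def)
    then show ?thesis
      using v U_shift[of x "j - i"] by (simp add: t_def s_def)
  qed
  have interval: "{a'..b'} = (\<lambda>x. x + t) ` {a..b}"
    by (simp add: t)
  have "H = (\<lambda>x. (x + t, v (x + t))) ` {a..b}"
    unfolding ab'(2) hump_def interval image_image ..
  also have "\<dots> = (\<lambda>x. (x + t, s * v x)) ` {a..b}"
    by (rule image_cong) (simp_all add: vs)
  also have "\<dots> = (\<lambda>(x, y). (x + t, s * y)) ` G"
    by (simp add: ab(2) hump_def image_image)
  finally show ?thesis
    unfolding same_hump_def by (intro exI[of _ t] bexI[of _ s]) (auto simp: s_def)
qed

lemma first_hump_symmetric:
  assumes v: "\<And>x. x \<in> {0..1} \<Longrightarrow> v x = U x"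
  shows "consecutive_zeros v 0 (1 / real n)"
    "symmetric_around (1 / (2 * real n)) (hump v 0 (1 / real n))"
proof -
  have n1: "0 < 1 / real n" "1 / real n \<le> 1" using n by auto
  have "U 0 = 0" "U (1 / real n) = 0"
    unfolding U_eq_0_iff by (auto intro: exI[of _ "0::int"] exI[of _ "1::int"])
  moreover have "v x \<noteq> 0" if "x \<in> {0<..<1 / real n}" for x
  proof -
    have "x \<in> {0..1}" using that n1(2) unfolding greaterThanLessThan_iff atLeastAtMost_iff by linarith
    then have "v x = U x" by (rule v)
    then show ?thesis using U_pos[of x] that by auto
  qed
  ultimately show "consecutive_zeros v 0 (1 / real n)"
    using v[of 0] v[of "1 / real n"] n1 by (auto simp: consecutive_zeros_def)
  have reflect: "v (1 / real n - x) = v x" if "x \<in> {0..1 / real n}" for x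
  proof -
    have "x \<in> {0..1}" "1 / real n - x \<in> {0..1}"
      using that n1(2) unfolding atLeastAtMost_iff by linarith+
    then show ?thesis
      by (simp only: v U_reflect)
  qed
  have "(\<lambda>(x, y). (2 * (1 / (2 * real n)) - x, y)) ` hump v 0 (1 / real n)
      = (\<lambda>x. (1 / real n - x, v x)) ` {0..1 / real n}"
    by (simp add: hump_def image_image)
  also have "\<dots> = (\<lambda>x. (1 / real n - x, v (1 / real n - x))) ` {0..1 / real n}"
    by (rule image_cong) (simp_all add: reflect)
  also have "\<dots> = (\<lambda>x. (x, v x)) ` ((\<lambda>x. 1 / real n - x) ` {0..1 / real n})"
    unfolding image_image ..
  also have "(\<lambda>x. 1 / real n - x) ` {0..1 / real n} = {0..1 / real n}"
    by simp
  finally show "symmetric_around (1 / (2 * real n)) (hump v 0 (1 / real n))"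
    by (simp add: symmetric_around_def hump_def)
qed

text \<open>
  Away from the grid the sine does not vanish, so the phase function is differentiable there as for
  positive \<open>c\<close>. The antiperiodicity of the profile reduces the slope at every grid point to the slope
  at \<open>0\<close>.
\<close>

lemma singular_solution_U:
  assumes "c = 0"
  shows "singular_solution \<kappa> n \<nu> l U"
proof -
  let ?S = "{0<..<1} - grid n"
  have "finite (grid n)"
    unfolding grid_def by (simp add: setcompr_eq_image[of _ "\<lambda>j. j \<le> n", simplified] finite_image_set)
  then have "open ?S"
    by (intro open_Diff finite_imp_closed) auto
  have pos: "0 < slope_cos c (angle c (sqrt (l / 2) * x))" if x: "x \<in> ?S" for x
  proof -
    have "U x \<noteq> 0"
    proof
      assume "U x = 0"
      then have "x \<in> (\<lambda>j. real j / real n) ` {1..<n}"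
        using x unfolding U_zeros[symmetric] by auto
      then show False using x by (auto simp: grid_def)
    qed
    then have "0 < \<kappa> * l * (profile \<kappa> l c x)\<^sup>2"
      using kappa l by (simp add: U_def)
    then show ?thesis
      using c unfolding slope_cos_profile[OF kappa l c01] by auto
  qed
  have bc: "U 0 = 0" "U 1 = 0"
    unfolding U_eq_0_iff using n by (auto intro: exI[of _ "0::int"] exI[of _ "int n"])
  have C2: "C2_on ?S U"
    unfolding U_def[abs_def]
  proof (rule profile_C2[OF kappa l c01 pos])
    show "at x within ?S \<noteq> bot" if "x \<in> ?S" for x
      using that \<open>open ?S\<close> by (simp add: at_within_open[of x ?S])
  qed
  have eq: "satisfies_equation \<kappa> l ?S U"
    unfolding U_def[abs_def] by (rule profile_equation[OF kappa l c01 nu \<open>open ?S\<close> pos])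
  have slope: "filterlim (\<lambda>x. \<nu> * (- 1) ^ j * ((U x - U p) / (x - p))) at_top (at p within {0..1})"
    if p: "p = real j / real n" for j p
  proof -
    define w where "w = sqrt (l / 2)"
    have w: "0 < w" using l by (simp add: w_def)
    have amp: "0 < amplitude \<kappa> l c" using c by (intro amplitude_pos kappa l) auto
    have "filterlim (\<lambda>x. w * (x - p)) (at 0) (at p within {0..1})"
      unfolding filterlim_at
    proof
      show "((\<lambda>x. w * (x - p)) \<longlongrightarrow> 0) (at p within {0..1})"
        by (auto intro!: tendsto_eq_intros)
      show "\<forall>\<^sub>F x in at p within {0..1}. w * (x - p) \<in> UNIV \<and> w * (x - p) \<noteq> 0"
        using w by (simp add: eventually_at_filter)
    qed
    from filterlim_compose[OF sin_angle_quotient_at_top this]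
    have "filterlim (\<lambda>x. (amplitude \<kappa> l c * w) * (sin (angle 0 (w * (x - p))) / (w * (x - p)))) at_top (at p within {0..1})"
      by (intro filterlim_tendsto_pos_mult_at_top[OF tendsto_const]) (use amp w in auto)
    moreover have "(amplitude \<kappa> l c * w) * (sin (angle 0 (w * (x - p))) / (w * (x - p)))
        = \<nu> * (- 1) ^ j * ((U x - U p) / (x - p))" for x
    proof -
      have "U p = 0"
        unfolding U_eq_0_iff p by (auto intro: exI[of _ "int j"])
      moreover have "U x = (- 1) ^ j * U (x - p)"
        using U_shift[of "x - p" "int j"] by (simp add: p minus_one_power_iff)
      ultimately have "\<nu> * (- 1) ^ j * ((U x - U p) / (x - p)) = \<nu> * U (x - p) / (x - p)"
        by (simp add: minus_one_power_iff)
      also have "\<nu> * U (x - p) = profile \<kappa> l c (x - p)"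
        by (simp add: U_def flip: mult.assoc)
      also have "profile \<kappa> l c (x - p) / (x - p)
          = (amplitude \<kappa> l c * w) * (sin (angle 0 (w * (x - p))) / (w * (x - p)))"
        using w by (simp add: profile_def assms w_def[symmetric])
      finally show ?thesis ..
    qed
    ultimately show ?thesis by simp
  qed
  show ?thesis
    using bc continuous_U C2 eq slope by (simp add: singular_solution_def Let_def)
qed

end

section \<open>Parameter and eigenvalue\<close>

definition eigenvalue :: "nat \<Rightarrow> real \<Rightarrow> real" where
  "eigenvalue n c = 8 * (real n)\<^sup>2 * (quarter c)\<^sup>2"

text \<open>
  The inverse of the eigenvalue relation: the cosine of the inclination at the zeros, for a given
  \<open>l\<close>.
\<close>

definition boundary_cos :: "nat \<Rightarrow> real \<Rightarrow> real" where
  "boundary_cos n = the_inv_into {0..1} (eigenvalue n)"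

lemma frequency_eigenvalue:
  assumes "c \<in> {0..1}"
  shows "sqrt (eigenvalue n c / 2) = 2 * real n * quarter c"
proof -
  have "eigenvalue n c / 2 = (2 * real n * quarter c)\<^sup>2"
    by (simp add: eigenvalue_def power_mult_distrib)
  then show ?thesis
    using quarter_pos[OF assms] by simp
qed

lemma eigenvalue_0: "eigenvalue n 0 = 8 * (real n)\<^sup>2 * B_const\<^sup>2"
  by (simp add: eigenvalue_def quarter_0)

lemma eigenvalue_1: "eigenvalue n 1 = (real n)\<^sup>2 * pi\<^sup>2"
  by (simp add: eigenvalue_def quarter_1 power_divide power_mult_distrib)

lemma eigenvalue_strict_mono:
  assumes "n \<ge> 1"
  shows "strict_mono_on {0..1} (eigenvalue n)"
proof (rule strict_mono_onI)
  fix c d :: real assume cd: "c \<in> {0..1}" "d \<in> {0..1}" "c < d"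
  then have "(quarter c)\<^sup>2 < (quarter d)\<^sup>2"
    using strict_mono_onD[OF quarter_strict_mono cd] quarter_pos[OF cd(1)] by (intro power_strict_mono) auto
  then show "eigenvalue n c < eigenvalue n d"
    using assms by (simp add: eigenvalue_def)
qed

lemma continuous_on_eigenvalue: "continuous_on {0..1} (eigenvalue n)"
  unfolding eigenvalue_def[abs_def] by (intro continuous_intros continuous_on_quarter)

lemma boundary_cos_eigenvalue: "n \<ge> 1 \<Longrightarrow> c \<in> {0..1} \<Longrightarrow> boundary_cos n (eigenvalue n c) = c"
  unfolding boundary_cos_def
  by (intro the_inv_into_f_f strict_mono_on_imp_inj_on eigenvalue_strict_mono)

lemma eigenvalue_less_iff:
  "n \<ge> 1 \<Longrightarrow> c \<in> {0..1} \<Longrightarrow> d \<in> {0..1} \<Longrightarrow> eigenvalue n c < eigenvalue n d \<longleftrightarrow> c < d"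
  using strict_mono_on_less[OF eigenvalue_strict_mono] by blast

lemma eigenvalue_image: 
  assumes "n \<ge> 1"
  shows "eigenvalue n ` {0..1} = {eigenvalue n 0..eigenvalue n 1}"
proof
  have "mono_on {0..1} (eigenvalue n)"
    by (rule strict_mono_on_imp_mono_on[OF eigenvalue_strict_mono[OF assms]])
  then show "eigenvalue n ` {0..1} \<subseteq> {eigenvalue n 0..eigenvalue n 1}"
    by (auto simp: mono_on_def)
  show "{eigenvalue n 0..eigenvalue n 1} \<subseteq> eigenvalue n ` {0..1}"
    using IVT'[of "eigenvalue n" 0 _ 1] continuous_on_eigenvalue by (force simp: image_iff)
qed

lemma continuous_on_boundary_cos:
  assumes "n \<ge> 1"
  shows "continuous_on {eigenvalue n 0..eigenvalue n 1} (boundary_cos n)"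
  using continuous_on_inv_into[OF continuous_on_eigenvalue _ strict_mono_on_imp_inj_on[OF eigenvalue_strict_mono[OF assms]]]
  by (simp add: boundary_cos_def eigenvalue_image[OF assms])

lemma boundary_cos_open_interval:
  assumes "n \<ge> 1" "l \<in> {eigenvalue n 0<..<eigenvalue n 1}"
  shows "boundary_cos n l \<in> {0<..<1}" "eigenvalue n (boundary_cos n l) = l"
proof -
  have "l \<in> eigenvalue n ` {0..1}"
    unfolding eigenvalue_image[OF assms(1)] using assms(2) by auto
  then obtain c where c: "c \<in> {0..1}" "l = eigenvalue n c" by auto
  then have "c \<in> {0<..<1}"
    using assms eigenvalue_less_iff[of n 0 c] eigenvalue_less_iff[of n c 1] by auto
  then show "boundary_cos n l \<in> {0<..<1}" "eigenvalue n (boundary_cos n l) = l"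
    using boundary_cos_eigenvalue[OF assms(1) c(1)] c(2) by auto
qed

lemma tuned_profile_eigenvalue:
  assumes "\<kappa> > 0" "n \<ge> 1" "\<nu> \<in> {1, -1}" "c \<in> {0..<1}"
  shows "tuned_profile \<kappa> (eigenvalue n c) c \<nu> n"
proof
  show "0 < eigenvalue n c"
    using quarter_pos[of c] assms by (simp add: eigenvalue_def)
  show "sqrt (eigenvalue n c / 2) = 2 * real n * quarter c"
    using assms by (intro frequency_eigenvalue) auto
qed (use assms in auto)

lemma (in tuned_profile) l_eq_eigenvalue: "l = eigenvalue n c"
proof -
  have "l / 2 = (sqrt (l / 2))\<^sup>2" using l by simp
  also have "\<dots> = eigenvalue n c / 2"
    unfolding frequency by (simp add: eigenvalue_def power_mult_distrib)
  finally show ?thesis by simp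
qed

text \<open>
  Since \<open>u\<close> vanishes at \<open>1\<close>, the profile is tuned to some number \<open>m\<close> of humps. All zeros are
  simple, because \<open>\<bar>u'\<bar>\<close> takes the same nonzero value at each of them by the first integral. Counting
  them gives \<open>m = n\<close>.
\<close>

lemma S_solution_obtains_profile:
  assumes "\<kappa> > 0" "n \<ge> 1" "\<nu> \<in> {1, -1}" and sol: "S_solution \<kappa> n \<nu> l u"
  obtains c where "c \<in> {0<..<1}" "tuned_profile \<kappa> l c \<nu> n"
    "\<forall>x\<in>{0..1}. u x = \<nu> * profile \<kappa> l c x"
    "\<nu> * deriv_on {0..1} u 0 = slope_at \<kappa> c 0"
proof -
  have classical: "classical_solution \<kappa> l u" and pos: "\<forall>\<^sub>F x in at_right 0. 0 < \<nu> * u x"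
    and zeros: "card (simple_zeros u) = n - 1"
    using sol by (auto simp: S_solution_def S_class_def)
  have bc: "u 0 = 0" "u 1 = 0"
    using classical by (auto simp: classical_solution_def)
  obtain c where par: "c \<in> {0<..<1}" "0 < l" "\<nu> * deriv_on {0..1} u 0 = slope_at \<kappa> c 0"
    "\<forall>x\<in>{0..1}. u x = \<nu> * profile \<kappa> l c x"
    by (rule classical_solution_profile[OF assms(1,3) classical pos])
  have "profile \<kappa> l c 1 = 0"
    using par(4) bc assms(3) by auto
  then obtain j :: int where j: "sqrt (l / 2) = 2 * of_int j * quarter c"
    using profile_eq_0_iff[OF assms(1) par(2), of c 1] par(1) by auto
  have "0 < 2 * of_int j * quarter c"
    unfolding j[symmetric] using par(2) by simp
  then have "0 < j"
    using quarter_pos[of c] par(1) by (simp add: zero_less_mult_iff)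
  define m where "m = nat j"
  interpret tuned_profile \<kappa> l c \<nu> m
    using assms par \<open>0 < j\<close> j by unfold_locales (auto simp: m_def)
  have "deriv u x \<noteq> 0" if "x \<in> {0<..<1}" "u x = 0" for x
  proof -
    note d = classical_solution_derivs[OF classical]
    have "1 / sqrt (1 + \<kappa> * (deriv_on {0..1} u x)\<^sup>2) = 1 / sqrt (1 + \<kappa> * (deriv_on {0..1} u 0)\<^sup>2)"
      using first_integral[OF assms(1) classical, of x] that by simp
    then have "(deriv_on {0..1} u x)\<^sup>2 = (deriv_on {0..1} u 0)\<^sup>2"
      using assms(1) by simp
    moreover have "deriv_on {0..1} u 0 \<noteq> 0"
      using par(3) slope_at_0(1)[OF assms(1) par(1)] by auto
    ultimately show ?thesis
      using DERIV_imp_deriv[OF d(4)[OF that(1)]] by auto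
  qed
  then have "simple_zeros u = {x \<in> {0<..<1}. U x = 0}"
    using par(4) by (auto simp: simple_zeros_def U_def)
  then have "m - 1 = n - 1"
    using U_zeros_card(2) zeros by simp
  then have "m = n"
    using assms(2) n by simp
  then show ?thesis
    using that par tuned_profile_axioms by auto
qed

lemma S_solution_boundary_cos:
  assumes "\<kappa> > 0" "n \<ge> 1" "\<nu> \<in> {1, -1}" "S_solution \<kappa> n \<nu> l u"
  shows "l \<in> {eigenvalue n 0<..<eigenvalue n 1}"
    and "tuned_profile \<kappa> l (boundary_cos n l) \<nu> n"
    and "\<And>x. x \<in> {0..1} \<Longrightarrow> u x = \<nu> * profile \<kappa> l (boundary_cos n l) x"
    and "\<nu> * deriv_on {0..1} u 0 = slope_at \<kappa> (boundary_cos n l) 0"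
proof -
  obtain c where c: "c \<in> {0<..<1}" "tuned_profile \<kappa> l c \<nu> n"
    "\<forall>x\<in>{0..1}. u x = \<nu> * profile \<kappa> l c x"
    "\<nu> * deriv_on {0..1} u 0 = slope_at \<kappa> c 0"
    by (rule S_solution_obtains_profile[OF assms])
  have l: "l = eigenvalue n c"
    by (rule tuned_profile.l_eq_eigenvalue[OF c(2)])
  then have "boundary_cos n l = c"
    using boundary_cos_eigenvalue[OF assms(2)] c(1) by auto
  then show "tuned_profile \<kappa> l (boundary_cos n l) \<nu> n"
    "\<And>x. x \<in> {0..1} \<Longrightarrow> u x = \<nu> * profile \<kappa> l (boundary_cos n l) x"
    "\<nu> * deriv_on {0..1} u 0 = slope_at \<kappa> (boundary_cos n l) 0"
    using c by auto
  show "l \<in> {eigenvalue n 0<..<eigenvalue n 1}"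
    unfolding l using c(1) assms(2) by (auto simp: eigenvalue_less_iff)
qed

lemma S_solution_exists:
  assumes "\<kappa> > 0" "n \<ge> 1" "\<nu> \<in> {1, -1}" "l \<in> {eigenvalue n 0<..<eigenvalue n 1}"
  shows "\<exists>u. S_solution \<kappa> n \<nu> l u"
proof -
  note m = boundary_cos_open_interval[OF assms(2,4)]
  interpret tuned_profile \<kappa> l "boundary_cos n l" \<nu> n
    using tuned_profile_eigenvalue[OF assms(1-3), of "boundary_cos n l"] m by auto
  show ?thesis
    using S_solution_U m(1) by auto
qed

text \<open>
  Immediate from \<open>1 + \<kappa> (slope_at \<kappa> c 0)\<^sup>2 = 1 / c\<^sup>2\<close>.
\<close>

lemma slope_at_0_strict_antimono:
  assumes "\<kappa> > 0" "c \<in> {0<..<1}" "d \<in> {0<..<1}" "c < d"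
  shows "slope_at \<kappa> d 0 < slope_at \<kappa> c 0"
proof (rule ccontr)
  assume "\<not> slope_at \<kappa> d 0 < slope_at \<kappa> c 0"
  then have "(slope_at \<kappa> c 0)\<^sup>2 \<le> (slope_at \<kappa> d 0)\<^sup>2"
    using slope_at_0(1)[OF assms(1,2)] by (intro power_mono) auto
  then have "1 / c\<^sup>2 \<le> 1 / d\<^sup>2"
    unfolding slope_at_0(2)[OF assms(1,2), symmetric] slope_at_0(2)[OF assms(1,3), symmetric]
    using assms(1) by simp
  moreover have "c\<^sup>2 < d\<^sup>2"
    using assms by (intro power_strict_mono) auto
  then have "1 / d\<^sup>2 < 1 / c\<^sup>2"
    using assms by (intro divide_strict_left_mono) auto
  ultimately show False by simp
qed

section \<open>The solution branches\<close>

theorem theorem1p1: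
  fixes \<kappa> \<nu> a b :: real and n :: nat
  assumes "\<kappa> > 0" and "n \<ge> 1" and "\<nu> \<in> {1, -1}"
    and a_def: "a = 8 * (real n)\<^sup>2 * B_const\<^sup>2"
    and b_def: "b = (real n)\<^sup>2 * pi\<^sup>2"
  shows
    "(\<forall>l. (\<exists>u. S_solution \<kappa> n \<nu> l u) \<longleftrightarrow> a < l \<and> l < b) \<and>
     (\<forall>l u v. S_solution \<kappa> n \<nu> l u \<and> S_solution \<kappa> n \<nu> l v \<longrightarrow> (\<forall>x\<in>{0..1}. u x = v x)) \<and>
     (\<forall>u. (\<forall>l\<in>{a<..<b}. S_solution \<kappa> n \<nu> l (u l)) \<longrightarrow>
        (\<forall>l\<in>{a<..<b}.
           (\<forall>G\<in>humps (u l). \<forall>H\<in>humps (u l). same_hump G H) \<and>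
           (\<exists>c. consecutive_zeros (u l) 0 c \<and>
                symmetric_around (1 / (2 * real n)) (hump (u l) 0 c))) \<and>
        strict_antimono_on {a<..<b} (\<lambda>l. \<nu> * deriv_on {0..1} (u l) 0) \<and>
        ((\<lambda>l. sup_norm (u l)) \<longlongrightarrow> 1 / (2 * real n * B_const * sqrt \<kappa>)) (at_right a) \<and>
        ((\<lambda>l. sup_norm (u l)) \<longlongrightarrow> 0) (at_left b) \<and>
        ((\<lambda>l. u l (1 / (2 * real n))) \<longlongrightarrow> 0) (at_left b) \<and>
        (\<exists>w. (\<forall>x\<in>{0..1}. ((\<lambda>l. u l x) \<longlongrightarrow> w x) (at_right a)) \<and>
             singular_solution \<kappa> n \<nu> a w))"
proof (intro conjI allI impI)
  have a: "a = eigenvalue n 0" and b: "b = eigenvalue n 1"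
    by (simp_all only: a_def b_def eigenvalue_0 eigenvalue_1)
  have n: "1 \<le> n" by fact
  note sol = S_solution_boundary_cos[OF assms(1-3), folded a b]
  note boundary_cos = boundary_cos_open_interval[OF n, folded a b]
  show "(\<exists>u. S_solution \<kappa> n \<nu> l u) = (a < l \<and> l < b)" for l
    using sol(1) S_solution_exists[OF assms(1-3), of l, folded a b] by auto
  show "\<forall>x\<in>{0..1}. u x = v x" if "S_solution \<kappa> n \<nu> l u \<and> S_solution \<kappa> n \<nu> l v" for l u v
    using sol(3)[of l u] sol(3)[of l v] that by simp
  fix u assume u: "\<forall>l\<in>{a<..<b}. S_solution \<kappa> n \<nu> l (u l)"
  have tuned: "tuned_profile \<kappa> l (boundary_cos n l) \<nu> n" if "l \<in> {a<..<b}" for l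
    using sol(2) u that by blast
  have u_eq: "u l x = tuned_profile.U \<kappa> l (boundary_cos n l) \<nu> x" if "l \<in> {a<..<b}" "x \<in> {0..1}" for l x
    using sol(3)[OF u[rule_format, OF that(1)] that(2)] by (simp add: tuned_profile.U_def[OF tuned[OF that(1)]])
  show "\<forall>l\<in>{a<..<b}.
           (\<forall>G\<in>humps (u l). \<forall>H\<in>humps (u l). same_hump G H) \<and>
           (\<exists>c. consecutive_zeros (u l) 0 c \<and>
                symmetric_around (1 / (2 * real n)) (hump (u l) 0 c))"
    using tuned_profile.same_humps[OF tuned u_eq] tuned_profile.first_hump_symmetric[OF tuned u_eq] by blast
  show "strict_antimono_on {a<..<b} (\<lambda>l. \<nu> * deriv_on {0..1} (u l) 0)"
  proof (rule monotone_onI)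
    fix l m assume lm: "l \<in> {a<..<b}" "m \<in> {a<..<b}" "l < m"
    then have "boundary_cos n l < boundary_cos n m"
      using eigenvalue_less_iff[OF n, of "boundary_cos n l" "boundary_cos n m"] boundary_cos[of l] boundary_cos[of m] by auto
    then have "slope_at \<kappa> (boundary_cos n m) 0 < slope_at \<kappa> (boundary_cos n l) 0"
      by (rule slope_at_0_strict_antimono[OF assms(1) boundary_cos(1)[OF lm(1)] boundary_cos(1)[OF lm(2)]])
    then show "\<nu> * deriv_on {0..1} (u l) 0 > \<nu> * deriv_on {0..1} (u m) 0"
      using sol(4)[OF u[rule_format, OF lm(1)]] sol(4)[OF u[rule_format, OF lm(2)]] by simp
  qed
  have "a < b"
    unfolding a b by (simp add: eigenvalue_less_iff[OF n])
  have "0 < a"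
    using quarter_pos[of 0] n by (simp add: a eigenvalue_def)
  have near_a: "\<forall>\<^sub>F l in at_right a. l \<in> {a<..<b}" and near_b: "\<forall>\<^sub>F l in at_left b. l \<in> {a<..<b}"
    by (rule eventually_at_right_real[OF \<open>a < b\<close>] eventually_at_left_real[OF \<open>a < b\<close>])+
  have boundary_cos_a: "(boundary_cos n \<longlongrightarrow> 0) (at_right a)" and boundary_cos_b: "(boundary_cos n \<longlongrightarrow> 1) (at_left b)"
    using continuous_on_Icc_at_rightD[OF continuous_on_boundary_cos[OF n, folded a b] \<open>a < b\<close>]
      continuous_on_Icc_at_leftD[OF continuous_on_boundary_cos[OF n, folded a b] \<open>a < b\<close>]
      boundary_cos_eigenvalue[OF n, of 0] boundary_cos_eigenvalue[OF n, of 1] by (simp_all add: a b)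
  have amp: "sup_norm (u l) = amplitude \<kappa> l (boundary_cos n l)" if "l \<in> {a<..<b}" for l
    by (rule tuned_profile.sup_norm_eq[OF tuned u_eq]) (use that in auto)
  have amp_a: "((\<lambda>l. amplitude \<kappa> l (boundary_cos n l)) \<longlongrightarrow> amplitude \<kappa> a 0) (at_right a)"
    unfolding amplitude_def using \<open>0 < a\<close> assms(1) by (intro tendsto_intros boundary_cos_a) auto
  have amp_b: "((\<lambda>l. amplitude \<kappa> l (boundary_cos n l)) \<longlongrightarrow> amplitude \<kappa> b 1) (at_left b)"
    unfolding amplitude_def using \<open>0 < a\<close> \<open>a < b\<close> assms(1) by (intro tendsto_intros boundary_cos_b) auto
  have "amplitude \<kappa> a 0 = sqrt ((1 / (2 * real n * B_const * sqrt \<kappa>))\<^sup>2)"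
    using assms(1) by (simp add: amplitude_def a_def power_divide power_mult_distrib mult_ac)
  also have "\<dots> = 1 / (2 * real n * B_const * sqrt \<kappa>)"
    using quarter_pos[of 0] assms(1) by (simp add: quarter_0)
  finally have amp_limit: "amplitude \<kappa> a 0 = 1 / (2 * real n * B_const * sqrt \<kappa>)" .
  show "((\<lambda>l. sup_norm (u l)) \<longlongrightarrow> 1 / (2 * real n * B_const * sqrt \<kappa>)) (at_right a)"
    by (rule Lim_transform_eventually[OF amp_a[unfolded amp_limit] eventually_mono[OF near_a]]) (simp add: amp)
  show norm_b: "((\<lambda>l. sup_norm (u l)) \<longlongrightarrow> 0) (at_left b)"
    by (rule Lim_transform_eventually[OF _ eventually_mono[OF near_b]], rule amp_b[simplified amplitude_def[of _ _ 1], simplified])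
      (simp add: amp)
  show "((\<lambda>l. u l (1 / (2 * real n))) \<longlongrightarrow> 0) (at_left b)"
  proof (rule Lim_null_comparison[OF eventually_mono[OF near_b] norm_b])
    fix l assume l: "l \<in> {a<..<b}"
    have "1 / (2 * real n) \<in> {0..1}" using n by (auto simp: field_simps)
    then show "norm (u l (1 / (2 * real n))) \<le> sup_norm (u l)"
      unfolding amp[OF l] u_eq[OF l \<open>1 / (2 * real n) \<in> {0..1}\<close>] real_norm_def
      by (intro tuned_profile.U_bound[OF tuned[OF l]])
  qed
  define w where "w x = \<nu> * profile \<kappa> a 0 x" for x
  have "tuned_profile \<kappa> a 0 \<nu> n"
    unfolding a by (rule tuned_profile_eigenvalue[OF assms(1-3)]) simp
  from tuned_profile.singular_solution_U[OF this] tuned_profile.U_def[OF this]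
  have "singular_solution \<kappa> n \<nu> a w"
    unfolding w_def[abs_def] by (metis ext)
  moreover have "((\<lambda>l. u l x) \<longlongrightarrow> w x) (at_right a)" if x: "x \<in> {0..1}" for x
  proof -
    have "((\<lambda>l. angle (boundary_cos n l) (sqrt (l / 2) * x)) \<longlongrightarrow> angle 0 (sqrt (a / 2) * x)) (at_right a)"
    proof (rule tendsto_angle[OF _ boundary_cos_a])
      show "\<forall>\<^sub>F l in at_right a. boundary_cos n l \<in> {0..1}"
        using near_a by eventually_elim (use boundary_cos(1) in fastforce)
      show "((\<lambda>l. sqrt (l / 2) * x) \<longlongrightarrow> sqrt (a / 2) * x) (at_right a)"
        by (intro tendsto_intros) auto
    qed simp
    then have "((\<lambda>l. \<nu> * profile \<kappa> l (boundary_cos n l) x) \<longlongrightarrow> w x) (at_right a)"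
      unfolding profile_def w_def by (intro tendsto_intros amp_a)
    then show ?thesis
      by (rule Lim_transform_eventually)
        (rule eventually_mono[OF near_a], rule sol(3)[OF u[rule_format] x, symmetric])
  qed
  ultimately show "\<exists>w. (\<forall>x\<in>{0..1}. ((\<lambda>l. u l x) \<longlongrightarrow> w x) (at_right a)) \<and> singular_solution \<kappa> n \<nu> a w"
    by blast
qed

end
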